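(* Assume independent strategy activation: $h_v(x)=1-\prod_{j=1}^d(1-q_{v,j}(x_j))$ for all $v\in V$, where each $q_{v,j}$ has values in $[0,1]$ and is non-decreasing, concave and $L_q$-Lipschitz; and assume $c$ is convex and $L_c$-Lipschitz. For any $\varepsilon,\ell>0$, with probability at least $1-\frac1{n^\ell}$ the algorithm $\mathsf{UpperGrad\text{-}RIS}$ outputs a solution $x\in\mathcal P$ that is a $(1-1/e-\varepsilon)$-approximation of the optimal value of CIM-BS, i.e. $(g+s)(x)\ge(1-1/e-\varepsilon)\,\mathrm{OPT}_{g+s}$, where $\mathrm{OPT}_{g+s}=\max_{y\in\mathcal P}(g+s)(y)$.
   Context: Model (CIM-BS). $G=(V,E)$ is a directed graph, $n=|V|$, $m=|E|$. In the triggering model each $v\in V$ has a distribution $D_v$ on subsets of its in-neighbours $N^-(v)$; each $v$ independently samples $T_v\sim D_v$. Given a seed set $S$, the nodes of $S$ are active at time $0$; active nodes stay active; at time $t\ge1$ a node $v$ becomes active if some node of $T_v$ is active at time $t-1$. $\sigma(S)$ is the expected final number of active nodes. $\mathcal D\subseteq\mathbb R_{\ge0}^d$ is a convex set of strategy mixes, and $h_v:\mathbb R_{\ge 0}^d\to[0,1]$ ($v\in V$) are the strategy activation functions. Put $g(x)=\sum_{S\subseteq V}\sigma(S)\prod_{u\in S}h_u(x)\prod_{v\notin S}(1-h_v(x))$. $c$ is the cost function, $k$ the budget, $\lambda\ge0$, $s(x)=\lambda(k-c(x))$, $\mathcal P=\{x\in\mathcal D:c(x)\le k\}$, and $\Delta\ge\max_{x,y\in\mathcal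 P}\|x-y\|_2$. CIM-BS is the problem of maximizing $g+s$ over $\mathcal P$. Lipschitz constants are with respect to the $2$-norm. RR sets. A (random) reverse reachable (RR) set: pick a root $v\in V$ uniformly at random, sample all $T_u$ ($u\in V$), and let $R$ be the set of nodes that can reach $v$ in the graph on $V$ with edges $\{(w,u):u\in V,w\in T_u\}$. For a sequence $\mathcal R$ of $\theta$ independent RR sets, $\hat g_{\mathcal R}(x)=\frac n\theta\sum_{R\in\mathcal R}\bigl(1-\prod_{v\in R}(1-h_v(x))\bigr)$, $\bar g_{\mathcal R}(x)=\frac n\theta\sum_{R\in\mathcal R}\min\{1,\sum_{v\in R,j\in[d]}q_{v,j}(x_j)\}$, and $\nu^{(1)}(\mathcal R)=\frac1\theta\sum_{R\in\mathcal R}|R|$. Covering number. A finite set $N$ is an $\epsilon$-net of $\mathcal P$ if every $x\in\mathcal P$ has some $\pi(x)\in N$ with $\|x-\pi(x)\|_2\le\epsilon$; $\mathcal N(\mathcal P,\epsilon)$ is the least cardinality of an $\epsilon$-net. Inner gradient algorithm $\mathcal A(\mathcal R)$. With $L=\nu^{(1)}(\mathcal R)n\sqrt d\,L_q+\lambda L_c$, run $T=9\Delta^2L^2/\varepsilon^2$ (rounded up) steps of the projected subgradient method for maximizing the concave function $\bar g_{\mathcal R}+s$ over $\mathcal P$ (move along a supergradient with step size $\eta_t=\Delta/(L\sqrt t)$, then project onto $\mathcal P$), starting in $\mathcal P$; return the iterate with the largest value of $\bar g_{\mathcal R}+s$. The supergradient of $\bar g_{\mathcal R}$ used is $\frac n\theta\sum_{R\in\mathcal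 R}w_R$, where $w_R=0$ if $\sum_{v\in R,j\in[d]}q_{v,j}(x_j)\ge1$ and $w_R=\sum_{v\in R,j\in[d]}\nabla q_{v,j}(x_j)$ otherwise. Algorithm $\mathsf{UpperGrad\text{-}RIS}$. Let $\alpha=1-\frac1e$ and $L_1=L_2=n^2\sqrt d\,L_q+\lambda L_c$. Set $LB=1$, $\mathcal R_0=\emptyset$, $\theta_0=0$, $\varepsilon'=\sqrt2\,\varepsilon/3$. For $i=1,2,\dots,\lfloor\log_2(n+\lambda k)-1\rfloor$: let $x_i=(n+\lambda k)/2^i$ and $\theta_i=\Bigl\lceil n(2+\tfrac23\varepsilon')\frac{\ln\mathcal N(\mathcal P,\frac{\varepsilon/3}{L_2}x_i)+\ell\ln n+\ln2+\ln\log_2(n+\lambda k)}{\varepsilon'^2x_i}\Bigr\rceil$; add $\theta_i-\theta_{i-1}$ new independent RR sets to $\mathcal R_{i-1}$ to form $\mathcal R_i$; let $y_i=\mathcal A(\mathcal R_i)$; if $(\hat g_{\mathcal R_i}+s)(y_i)\ge(1+\varepsilon'+\varepsilon/3)x_i$, set $LB=\frac{(\hat g_{\mathcal R_i}+s)(y_i)}{1+\varepsilon'+\varepsilon/3}$ and leave the loop. Then put $\theta^{(1)}=\frac{8n\ln(4n^\ell)}{LB\,(\alpha-\varepsilon/3)^2\varepsilon^2/9}$, $\theta^{(2)}=\frac{2\alpha' n\ln\left(4n^\ell\mathcal N(\mathcal P,\frac{\varepsilon/3}{L_1+L_2}LB)\right)}{\left(\varepsilon/3-\frac14(\alpha-\varepsilon/3)^2\varepsilon/3\right)^2LB}$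 with $\alpha'=\alpha-\varepsilon/3$, and $\tilde\theta=\max\{\theta^{(1)},\theta^{(2)}\}$ (rounded up); generate a fresh sequence $\mathcal R$ of $\tilde\theta$ independent RR sets, and output $x=\mathcal A(\mathcal R)$.
   Formalization: The optimal value is assumed to be at least 1 (so LB=1 is a valid start), since the claim fails for small optimal values; P is assumed nonempty and closed, n+λk>0, and the supergradients of q and s used are bounded by L_q and λL_c. *)

theory Defs
  imports "HOL-Probability.Probability"
begin

record ('v, 'd::finite) cim_bs =
  verts :: "'v set"
  edges :: "('v \<times> 'v) set"
  trig :: "'v \<Rightarrow> 'v set pmf"
  mixes :: "(real ^ 'd) set"
  act :: "'v \<Rightarrow> real ^ 'd \<Rightarrow> real"
  cost :: "real ^ 'd \<Rightarrow> real"
  budget :: real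
  saving_wt :: real

(* sgrad_q and sgrad_s select supergradients of the functions q_(v,j) and of s; they are
   inputs because these functions need not be differentiable. *)
record ('v, 'd::finite) ris_input = "('v, 'd) cim_bs" +
  strat_act :: "'v \<Rightarrow> 'd \<Rightarrow> real \<Rightarrow> real"
  lip_q :: real
  lip_c :: real
  diam_bd :: real
  sgrad_q :: "'v \<Rightarrow> 'd \<Rightarrow> real \<Rightarrow> real"
  sgrad_s :: "real ^ 'd \<Rightarrow> real ^ 'd"
  start :: "real ^ 'd"

abbreviation num_verts :: "('v, 'd::finite, 'z) cim_bs_scheme \<Rightarrow> real" where
  "num_verts I \<equiv> real (card (verts I))"

abbreviation nonneg_orthant :: "(real ^ 'd::finite) set" where
  "nonneg_orthant \<equiv> {x. \<forall>j. 0 \<le> x $ j}"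

(* The value {} outside verts I is the dummy default that Pi_pmf requires. *)
definition trigger_sets :: "('v, 'd::finite, 'z) cim_bs_scheme \<Rightarrow> ('v \<Rightarrow> 'v set) pmf" where
  "trigger_sets I = Pi_pmf (verts I) {} (trig I)"

primrec active :: "'v set \<Rightarrow> ('v \<Rightarrow> 'v set) \<Rightarrow> 'v set \<Rightarrow> nat \<Rightarrow> 'v set" where
  "active V T S 0 = S"
| "active V T S (Suc t) = active V T S t \<union> {v \<in> V. T v \<inter> active V T S t \<noteq> {}}"

definition spread :: "('v, 'd::finite, 'z) cim_bs_scheme \<Rightarrow> 'v set \<Rightarrow> real" where
  "spread I S = measure_pmf.expectation (trigger_sets I)
     (\<lambda>T. real (card (\<Union>t. active (verts I) T S t)))"

definition influence :: "('v, 'd::finite, 'z) cim_bs_scheme \<Rightarrow> real ^ 'd \<Rightarrow> real" where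
  "influence I x = (\<Sum>S\<in>Pow (verts I).
     spread I S * (\<Prod>u\<in>S. act I u x) * (\<Prod>v\<in>verts I - S. 1 - act I v x))"

definition saving :: "('v, 'd::finite, 'z) cim_bs_scheme \<Rightarrow> real ^ 'd \<Rightarrow> real" where
  "saving I x = saving_wt I * (budget I - cost I x)"

definition feasible :: "('v, 'd::finite, 'z) cim_bs_scheme \<Rightarrow> (real ^ 'd) set" where
  "feasible I = {x \<in> mixes I. cost I x \<le> budget I}"

(* A maximum whenever feasible I is nonempty and compact and the objective is continuous. *)
definition opt_value :: "('v, 'd::finite, 'z) cim_bs_scheme \<Rightarrow> real" where
  "opt_value I = (SUP y\<in>feasible I. influence I y + saving I y)"

definition rr_set :: "'v set \<Rightarrow> ('v \<Rightarrow> 'v set) \<Rightarrow> 'v \<Rightarrow> 'v set" where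
  "rr_set V T v = {w. (w, v) \<in> {(w, u). u \<in> V \<and> w \<in> T u}\<^sup>*}"

definition rr_pmf :: "('v, 'd::finite, 'z) cim_bs_scheme \<Rightarrow> 'v set pmf" where
  "rr_pmf I = do {
     v \<leftarrow> pmf_of_set (verts I);
     T \<leftarrow> trigger_sets I;
     return_pmf (rr_set (verts I) T v)
   }"

definition g_hat :: "('v, 'd::finite, 'z) cim_bs_scheme \<Rightarrow> 'v set list \<Rightarrow> real ^ 'd \<Rightarrow> real" where
  "g_hat I Rs x = num_verts I / real (length Rs) * (\<Sum>R\<leftarrow>Rs. 1 - (\<Prod>v\<in>R. 1 - act I v x))"

definition q_sum :: "('v, 'd::finite, 'z) ris_input_scheme \<Rightarrow> 'v set \<Rightarrow> real ^ 'd \<Rightarrow> real" where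
  "q_sum I R x = (\<Sum>v\<in>R. \<Sum>j\<in>UNIV. strat_act I v j (x $ j))"

definition g_bar :: "('v, 'd::finite, 'z) ris_input_scheme \<Rightarrow> 'v set list \<Rightarrow> real ^ 'd \<Rightarrow> real" where
  "g_bar I Rs x = num_verts I / real (length Rs) * (\<Sum>R\<leftarrow>Rs. min 1 (q_sum I R x))"

definition nu1 :: "'v set list \<Rightarrow> real" where
  "nu1 Rs = (\<Sum>R\<leftarrow>Rs. real (card R)) / real (length Rs)"

definition is_net :: "'a::metric_space set \<Rightarrow> real \<Rightarrow> 'a set \<Rightarrow> bool" where
  "is_net P r N \<longleftrightarrow> finite N \<and> (\<forall>x\<in>P. \<exists>y\<in>N. dist x y \<le> r)"

definition covering_number :: "'a::metric_space set \<Rightarrow> real \<Rightarrow> nat" where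
  "covering_number P r = (LEAST m. \<exists>N. is_net P r N \<and> card N = m)"

definition supergradient_on ::
    "'a::real_inner set \<Rightarrow> ('a \<Rightarrow> real) \<Rightarrow> 'a \<Rightarrow> 'a \<Rightarrow> bool" where
  "supergradient_on S f x u \<longleftrightarrow> (\<forall>y\<in>S. f y \<le> f x + u \<bullet> (y - x))"

definition sgrad_gbar ::
    "('v, 'd::finite, 'z) ris_input_scheme \<Rightarrow> 'v set list \<Rightarrow> real ^ 'd \<Rightarrow> real ^ 'd" where
  "sgrad_gbar I Rs x = (num_verts I / real (length Rs)) *\<^sub>R
     (\<Sum>R\<leftarrow>Rs. if q_sum I R x \<ge> 1 then 0 else (\<chi> j. \<Sum>v\<in>R. sgrad_q I v j (x $ j)))"

definition inner_lip :: "('v, 'd::finite, 'z) ris_input_scheme \<Rightarrow> 'v set list \<Rightarrow> real" where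
  "inner_lip I Rs =
     nu1 Rs * num_verts I * sqrt (real CARD('d)) * lip_q I + saving_wt I * lip_c I"

(* Indices are shifted: the step from iterate t to iterate Suc t is step number Suc t. *)
primrec iterate ::
    "('v, 'd::finite, 'z) ris_input_scheme \<Rightarrow> 'v set list \<Rightarrow> nat \<Rightarrow> real ^ 'd" where
  "iterate I Rs 0 = start I"
| "iterate I Rs (Suc t) = closest_point (feasible I)
     (iterate I Rs t + (diam_bd I / (inner_lip I Rs * sqrt (real (Suc t)))) *\<^sub>R
        (sgrad_gbar I Rs (iterate I Rs t) + sgrad_s I (iterate I Rs t)))"

definition num_steps :: "('v, 'd::finite, 'z) ris_input_scheme \<Rightarrow> real \<Rightarrow> 'v set list \<Rightarrow> nat" where
  "num_steps I \<epsilon> Rs = nat \<lceil>9 * (diam_bd I)\<^sup>2 * (inner_lip I Rs)\<^sup>2 / \<epsilon>\<^sup>2\<rceil>"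

definition inner_alg ::
    "('v, 'd::finite, 'z) ris_input_scheme \<Rightarrow> real \<Rightarrow> 'v set list \<Rightarrow> real ^ 'd" where
  "inner_alg I \<epsilon> Rs =
     arg_max_on (\<lambda>x. g_bar I Rs x + saving I x) (iterate I Rs ` {..num_steps I \<epsilon> Rs})"

(* The common value of L_1 and L_2. If it is 0, the quotients by it below are 0 rather than
   infinite; in that case g + s is constant on the feasible set. *)
definition global_lip :: "('v, 'd::finite, 'z) ris_input_scheme \<Rightarrow> real" where
  "global_lip I = (num_verts I)\<^sup>2 * sqrt (real CARD('d)) * lip_q I + saving_wt I * lip_c I"

definition obj_bound :: "('v, 'd::finite, 'z) cim_bs_scheme \<Rightarrow> real" where
  "obj_bound I = num_verts I + saving_wt I * budget I"

definition guess :: "('v, 'd::finite, 'z) cim_bs_scheme \<Rightarrow> nat \<Rightarrow> real" where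
  "guess I i = obj_bound I / 2 ^ i"

abbreviation eps_prime :: "real \<Rightarrow> real" where
  "eps_prime \<epsilon> \<equiv> sqrt 2 * \<epsilon> / 3"

definition theta ::
    "('v, 'd::finite, 'z) ris_input_scheme \<Rightarrow> real \<Rightarrow> real \<Rightarrow> nat \<Rightarrow> nat" where
  "theta I \<epsilon> l i = (if i = 0 then 0 else
     nat \<lceil>num_verts I * (2 + 2 / 3 * eps_prime \<epsilon>) *
       ((ln (real (covering_number (feasible I) (\<epsilon> / 3 / global_lip I * guess I i)))
          + l * ln (num_verts I) + ln 2 + ln (log 2 (obj_bound I)))
        / ((eps_prime \<epsilon>)\<^sup>2 * guess I i))\<rceil>)"

(* lb_search I eps l r i Rs is the remainder of the loop when r passes are left, the next
   one has index i, and Rs is the current sequence of RR sets. *)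
primrec lb_search ::
    "('v, 'd::finite, 'z) ris_input_scheme \<Rightarrow> real \<Rightarrow> real \<Rightarrow> nat \<Rightarrow> nat \<Rightarrow> 'v set list \<Rightarrow> real pmf"
where
  "lb_search I \<epsilon> l 0 i Rs = return_pmf 1"
| "lb_search I \<epsilon> l (Suc r) i Rs = do {
     new \<leftarrow> replicate_pmf (theta I \<epsilon> l i - theta I \<epsilon> l (i - 1)) (rr_pmf I);
     let Rs' = Rs @ new;
     let y = inner_alg I \<epsilon> Rs';
     let val = g_hat I Rs' y + saving I y;
     let b = 1 + eps_prime \<epsilon> + \<epsilon> / 3;
     if val \<ge> b * guess I i then return_pmf (val / b)
     else lb_search I \<epsilon> l r (Suc i) Rs'
   }"

definition lower_bound ::
    "('v, 'd::finite, 'z) ris_input_scheme \<Rightarrow> real \<Rightarrow> real \<Rightarrow> real pmf" where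
  "lower_bound I \<epsilon> l = lb_search I \<epsilon> l (nat \<lfloor>log 2 (obj_bound I) - 1\<rfloor>) 1 []"

abbreviation alpha :: real where
  "alpha \<equiv> 1 - 1 / exp 1"

definition theta1 ::
    "('v, 'd::finite, 'z) ris_input_scheme \<Rightarrow> real \<Rightarrow> real \<Rightarrow> real \<Rightarrow> real" where
  "theta1 I \<epsilon> l LB =
     8 * num_verts I * ln (4 * num_verts I powr l) / (LB * (alpha - \<epsilon> / 3)\<^sup>2 * \<epsilon>\<^sup>2 / 9)"

definition theta2 ::
    "('v, 'd::finite, 'z) ris_input_scheme \<Rightarrow> real \<Rightarrow> real \<Rightarrow> real \<Rightarrow> real" where
  "theta2 I \<epsilon> l LB =
     2 * (alpha - \<epsilon> / 3) * num_verts I *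
       ln (4 * num_verts I powr l *
           real (covering_number (feasible I) (\<epsilon> / 3 / (global_lip I + global_lip I) * LB)))
     / ((\<epsilon> / 3 - 1 / 4 * (alpha - \<epsilon> / 3)\<^sup>2 * \<epsilon> / 3)\<^sup>2 * LB)"

definition upper_grad_ris ::
    "('v, 'd::finite, 'z) ris_input_scheme \<Rightarrow> real \<Rightarrow> real \<Rightarrow> (real ^ 'd) pmf" where
  "upper_grad_ris I \<epsilon> l = do {
     LB \<leftarrow> lower_bound I \<epsilon> l;
     Rs \<leftarrow> replicate_pmf (nat \<lceil>max (theta1 I \<epsilon> l LB) (theta2 I \<epsilon> l LB)\<rceil>) (rr_pmf I);
     return_pmf (inner_alg I \<epsilon> Rs)
   }"

end

(* Only LB <= OPT is needed from the search phase: a value returned above OPT forces the estimate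
   g_hat to exceed g by a fixed multiple of max(OPT, x_i) at some net point, which Bernstein's
   inequality and a union bound exclude. In the final phase the inner algorithm loses the factor
   1 - 1/e (since 1 - prod (1 - a_i) >= (1 - 1/e) min(1, sum a_i)) and an additive eps/2, which is
   at most eps/2 * OPT because OPT >= 1. A failing output then forces either g_hat to be small at
   an optimal point, excluded by theta1 and the lower tail, or g_hat - g to be large at a net
   point, excluded by theta2 and the upper tail. *)

theory Submission
  imports Defs
begin

text \<open>The output of the inner algorithm depends on the sample, so a tail bound at a fixed
  point says nothing about it; every bad event is moved to a nearby net point before its probability
  is estimated. Error budget of the final phase, with OPT for \<open>opt_value I\<close>, alpha' =
  alpha - \<epsilon>/3 and e1 = alpha' \<epsilon>/6 the relative deviation tolerated at the optimum:
  a failing output has g_hat - g at least (\<epsilon> - alpha e1 - alpha \<epsilon>/2) OPT. Moving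
  to the net costs a further \<epsilon>/6 OPT, since the net radius divides by twice the Lipschitz
  constant. As alpha <= 2/3, more than \<epsilon>/3 OPT is left, which covers the deviation built
  into \<open>theta2\<close>. The factor alpha' in \<open>theta2\<close> is affordable because only
  net points with g at most (alpha - 5/6 \<epsilon>) OPT matter, and this bound on the mean plays
  the part of the variance in Bernstein's inequality. The failure probability is 1/(2 n^l) for the
  search and 1/(4 n^l) for each of the two events of the final phase.\<close>

section \<open>Scalar inequalities for the exponential function\<close>

text \<open>The Taylor tail is dominated by a geometric series of ratio x / 3, since (k + 2)! >= 2 *
  3^k. The correction 1 - x / 3 is the origin of the term 2/3 \<delta> in Bernstein's
  inequality.\<close>

lemma exp_taylor_bound:
  fixes x :: real
  assumes "0 \<le> x" "x < 3"
  shows "exp x - 1 - x \<le> x\<^sup>2 / (2 * (1 - x / 3))"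
proof -
  have fact_bound: "2 * 3 ^ k \<le> (fact (k + 2) :: real)" for k
  proof (induction k)
    case (Suc k)
    have "2 * 3 ^ Suc k = (3::real) * (2 * 3 ^ k)" by simp
    also have "\<dots> \<le> real (k + 3) * fact (k + 2)"
      by (intro mult_mono) (use Suc in auto)
    also have "\<dots> = fact (Suc k + 2)" by (simp add: algebra_simps)
    finally show ?case .
  qed simp
  have "(\<lambda>k. x ^ k / fact k) sums exp x"
    using exp_converges[of x] by (simp add: divide_inverse mult.commute)
  from sums_split_initial_segment[OF this, of 2]
  have lhs: "(\<lambda>k. x ^ (k + 2) / fact (k + 2)) sums (exp x - 1 - x)"
    by (simp add: numeral_2_eq_2 diff_diff_eq)
  have rhs: "(\<lambda>k. x\<^sup>2 / 2 * (x / 3) ^ k) sums (x\<^sup>2 / 2 * (1 / (1 - x / 3)))"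
    using assms by (intro sums_mult geometric_sums) auto
  have le: "x ^ (k + 2) / fact (k + 2) \<le> x\<^sup>2 / 2 * (x / 3) ^ k" for k
  proof -
    have "x ^ (k + 2) / fact (k + 2) \<le> x ^ (k + 2) / (2 * 3 ^ k)"
      using fact_bound[of k] assms by (intro divide_left_mono) auto
    also have "\<dots> = x\<^sup>2 / 2 * (x / 3) ^ k"
      by (simp add: power_add power_divide power2_eq_square)
    finally show ?thesis .
  qed
  have "exp x - 1 - x \<le> x\<^sup>2 / 2 * (1 / (1 - x / 3))"
    by (rule sums_le[OF le lhs rhs])
  then show ?thesis by simp
qed

text \<open>For a negative exponent the plain quadratic bound holds, so the lower tail gets the
  cleaner denominator 2 M. The gap vanishes at 0 and has derivative t + exp (- t) - 1 >= 0.\<close>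

lemma exp_minus_taylor_bound:
  fixes x :: real
  assumes "0 \<le> x"
  shows "exp (- x) - 1 + x \<le> x\<^sup>2 / 2"
proof -
  let ?f = "\<lambda>x :: real. x\<^sup>2 / 2 - exp (- x) + 1 - x"
  have "?f 0 \<le> ?f x"
  proof (rule DERIV_nonneg_imp_nondecreasing[OF assms])
    fix t :: real
    have "(?f has_real_derivative (t + exp (- t) - 1)) (at t)"
      by (auto intro!: derivative_eq_intros)
    moreover have "0 \<le> t + exp (- t) - 1"
      using exp_ge_add_one_self[of "- t"] by linarith
    ultimately show "\<exists>y. (?f has_real_derivative y) (at t) \<and> 0 \<le> y" by blast
  qed
  then show ?thesis by simp
qed

text \<open>On [0, 1] the convex function exp (- s) lies below its chord from 1 to 1/e; beyond 1,
  monotonicity suffices. The approximation ratio 1 - 1/e originates here.\<close>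

lemma one_minus_exp_ge_min:
  fixes s :: real
  assumes "0 \<le> s"
  shows "(1 - 1 / exp 1) * min 1 s \<le> 1 - exp (- s)"
proof (cases "1 \<le> s")
  case True
  then have "exp (- s) \<le> exp (- 1)" by simp
  with True show ?thesis by (simp add: exp_minus divide_inverse)
next
  case False
  have "exp (s * (- 1) + (1 - s) * 0) \<le> s * exp (- 1) + (1 - s) * exp (0::real)"
    using convex_onD[OF exp_convex, of "s" 0 "-1::real"] assms False by (simp add: algebra_simps)
  with False show ?thesis by (simp add: exp_minus divide_inverse algebra_simps)
qed

section \<open>Exponential moments and tail bounds for independent samples\<close>

lemma sum_list_mono_bound:
  fixes f :: "'a \<Rightarrow> real"
  assumes "\<And>x. x \<in> set xs \<Longrightarrow> f x \<le> c"
  shows "(\<Sum>x\<leftarrow>xs. f x) \<le> real (length xs) * c"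
  using assms by (induction xs) (auto simp: algebra_simps add_mono)

lemma finite_set_replicate_pmf:
  assumes "finite (set_pmf p)"
  shows "finite (set_pmf (replicate_pmf m p))"
proof -
  have "{xs \<in> lists (set_pmf p). length xs = m} = {xs. set xs \<subseteq> set_pmf p \<and> length xs = m}" by auto
  then show ?thesis
    using finite_lists_length_eq[OF assms, of m] by (simp add: set_replicate_pmf)
qed

text \<open>Independence in the form of a product of moment generating functions. Finite support
  settles the integrability questions, here and in the tail bounds.\<close>

lemma expectation_exp_replicate_pmf:
  fixes f :: "'a \<Rightarrow> real"
  assumes fin: "finite (set_pmf p)"
  shows "measure_pmf.expectation (replicate_pmf m p) (\<lambda>xs. exp (t * (\<Sum>x\<leftarrow>xs. f x)))
     = measure_pmf.expectation p (\<lambda>x. exp (t * f x)) ^ m"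
proof (induction m)
  case (Suc m)
  have "measure_pmf.expectation (replicate_pmf (Suc m) p) (\<lambda>xs. exp (t * (\<Sum>x\<leftarrow>xs. f x)))
     = (\<Sum>x\<in>set_pmf p. pmf p x *\<^sub>R measure_pmf.expectation (replicate_pmf m p)
          (\<lambda>xs. exp (t * f x) * exp (t * (\<Sum>x\<leftarrow>xs. f x))))"
    unfolding replicate_pmf.simps
    by (subst pmf_expectation_bind[of "set_pmf p"])
       (auto simp: fin finite_set_replicate_pmf map_pmf_def[symmetric] distrib_left exp_add)
  also have "\<dots> = (\<Sum>x\<in>set_pmf p. pmf p x *\<^sub>R exp (t * f x)) *
      measure_pmf.expectation p (\<lambda>x. exp (t * f x)) ^ m"
    by (simp add: Suc sum_distrib_right mult.assoc)
  also have "(\<Sum>x\<in>set_pmf p. pmf p x *\<^sub>R exp (t * f x)) = measure_pmf.expectation p (\<lambda>x. exp (t * f x))"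
    by (subst integral_measure_pmf[of "set_pmf p"]) (auto simp: fin)
  finally show ?case by simp
qed simp

text \<open>For a in [0, 1] the chord bound exp (t a) <= 1 + (exp t - 1) a holds for either sign of
  t, so one estimate in terms of the mean serves both tails.\<close>

lemma exp_moment_bound:
  fixes f :: "'a \<Rightarrow> real"
  assumes fin: "finite (set_pmf p)"
    and f01: "\<And>x. x \<in> set_pmf p \<Longrightarrow> 0 \<le> f x \<and> f x \<le> 1"
  shows "measure_pmf.expectation p (\<lambda>x. exp (t * f x)) \<le>
    exp ((exp t - 1) * measure_pmf.expectation p f)"
proof -
  note int = integrable_measure_pmf_finite[OF fin]
  have "measure_pmf.expectation p (\<lambda>x. exp (t * f x)) \<le>
      measure_pmf.expectation p (\<lambda>x. 1 + (exp t - 1) * f x)"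
  proof (rule integral_mono_AE[OF int int AE_pmfI])
    fix x assume "x \<in> set_pmf p"
    then have "0 \<le> f x" "f x \<le> 1" using f01 by auto
    then show "exp (t * f x) \<le> 1 + (exp t - 1) * f x"
      using convex_onD[OF exp_convex, of "f x" 0 t] by (simp add: algebra_simps)
  qed
  also have "\<dots> = 1 + (exp t - 1) * measure_pmf.expectation p f"
    by (subst Bochner_Integration.integral_add) (auto intro!: int)
  also have "\<dots> \<le> exp ((exp t - 1) * measure_pmf.expectation p f)"
    by (rule exp_ge_add_one_self)
  finally show ?thesis .
qed

text \<open>The factor t stays inside the event so that t > 0 yields the upper tail and t < 0 the
  lower tail.\<close>

lemma chernoff_replicate_pmf:
  fixes f :: "'a \<Rightarrow> real"
  assumes fin: "finite (set_pmf p)"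
    and f01: "\<And>x. x \<in> set_pmf p \<Longrightarrow> 0 \<le> f x \<and> f x \<le> 1"
  shows "measure_pmf.prob (replicate_pmf m p) {xs. t * (\<Sum>x\<leftarrow>xs. f x) \<ge> a}
    \<le> exp (real m * (exp t - 1) * measure_pmf.expectation p f - a)"
proof -
  let ?M = "replicate_pmf m p" and ?g = "\<lambda>xs. exp (t * (\<Sum>x\<leftarrow>xs. f x))"
  have "measure_pmf.prob ?M {xs \<in> space ?M. ?g xs \<ge> exp a} \<le> measure_pmf.expectation ?M ?g / exp a"
    by (rule integral_Markov_inequality_measure[where A = "{}"])
       (auto intro: integrable_measure_pmf_finite finite_set_replicate_pmf fin)
  also have "\<dots> \<le> exp ((exp t - 1) * measure_pmf.expectation p f) ^ m / exp a"
    unfolding expectation_exp_replicate_pmf[OF fin]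
    by (intro divide_right_mono power_mono exp_moment_bound assms) auto
  also have "\<dots> = exp (real m * (exp t - 1) * measure_pmf.expectation p f - a)"
    by (simp add: exp_of_nat_mult[symmetric] exp_diff mult.assoc)
  finally show ?thesis by simp
qed

text \<open>The variance of a [0, 1]-valued variable is at most its mean, so an upper bound M of the
  mean takes its place. The choice of M is left open because the two phases use different
  ones.\<close>

lemma bernstein_replicate_pmf:
  fixes f :: "'a \<Rightarrow> real"
  assumes fin: "finite (set_pmf p)"
    and f01: "\<And>x. x \<in> set_pmf p \<Longrightarrow> 0 \<le> f x \<and> f x \<le> 1"
    and M: "measure_pmf.expectation p f \<le> M" "0 < M" and "0 < \<delta>" "0 < m"
  shows "measure_pmf.prob (replicate_pmf m p)
      {xs. (\<Sum>x\<leftarrow>xs. f x) \<ge> real m * (measure_pmf.expectation p f + \<delta>)}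
    \<le> exp (- (real m * \<delta>\<^sup>2 / (2 * M + 2 / 3 * \<delta>)))"
proof -
  let ?\<mu> = "measure_pmf.expectation p f"
  \<comment> \<open>The usual Bernstein exponent: it gives 1 - t / 3 = M / (M + \<delta> / 3), which
    makes the quadratic term below exactly half of the linear term t * \<delta>.\<close>
  define t where "t = \<delta> / (M + \<delta> / 3)"
  have t: "0 < t" "t < 3" using assms by (auto simp: t_def field_simps)
  have "{xs. (\<Sum>x\<leftarrow>xs. f x) \<ge> real m * (?\<mu> + \<delta>)} =
      {xs. t * (\<Sum>x\<leftarrow>xs. f x) \<ge> t * (real m * (?\<mu> + \<delta>))}"
    using t by simp
  then have "measure_pmf.prob (replicate_pmf m p) {xs. (\<Sum>x\<leftarrow>xs. f x) \<ge> real m * (?\<mu> + \<delta>)}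
      \<le> exp (real m * (exp t - 1) * ?\<mu> - t * (real m * (?\<mu> + \<delta>)))"
    using chernoff_replicate_pmf[where p = p and f = f and t = t and m = m, OF fin f01] by auto
  also have "real m * (exp t - 1) * ?\<mu> - t * (real m * (?\<mu> + \<delta>)) =
      real m * ((exp t - 1 - t) * ?\<mu> - t * \<delta>)"
    by (simp add: algebra_simps)
  also have "\<dots> \<le> real m * (t\<^sup>2 / (2 * (1 - t / 3)) * M - t * \<delta>)"
  proof -
    have "(exp t - 1 - t) * ?\<mu> \<le> (exp t - 1 - t) * M"
      using exp_ge_add_one_self[of t] M by (intro mult_left_mono) linarith+
    also have "\<dots> \<le> t\<^sup>2 / (2 * (1 - t / 3)) * M"
      using t M by (intro mult_right_mono exp_taylor_bound) auto
    finally show ?thesis by (simp add: mult_left_mono)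
  qed
  also have "t\<^sup>2 / (2 * (1 - t / 3)) * M - t * \<delta> = - (\<delta>\<^sup>2 / (2 * M + 2 / 3 * \<delta>))"
  proof -
    define D where "D = M + \<delta> / 3"
    have D: "D > 0" "M = D - \<delta> / 3" using assms by (auto simp: D_def)
    have t_eq: "t = \<delta> / D" by (simp add: t_def D_def)
    then have quot: "1 - t / 3 = M / D" using D(1) by (simp add: D(2) diff_divide_distrib)
    have "t\<^sup>2 / (2 * (1 - t / 3)) * M = \<delta>\<^sup>2 / (2 * D)"
      unfolding quot unfolding t_eq using D(1) M(2) by (simp add: power2_eq_square)
    moreover have "t * \<delta> = \<delta>\<^sup>2 / D" by (simp add: t_def D_def[symmetric] power2_eq_square)
    moreover have "2 * M + 2 / 3 * \<delta> = 2 * D" by (simp add: D_def)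
    ultimately show ?thesis using D(1) by (simp add: field_simps)
  qed
  finally show ?thesis by simp
qed

lemma lower_tail_replicate_pmf:
  fixes f :: "'a \<Rightarrow> real"
  assumes fin: "finite (set_pmf p)"
    and f01: "\<And>x. x \<in> set_pmf p \<Longrightarrow> 0 \<le> f x \<and> f x \<le> 1"
    and M: "measure_pmf.expectation p f \<le> M" "0 < M" and "0 < \<delta>" "0 < m"
  shows "measure_pmf.prob (replicate_pmf m p)
      {xs. (\<Sum>x\<leftarrow>xs. f x) \<le> real m * (measure_pmf.expectation p f - \<delta>)}
    \<le> exp (- (real m * \<delta>\<^sup>2 / (2 * M)))"
proof -
  let ?\<mu> = "measure_pmf.expectation p f"
  have \<mu>: "0 \<le> ?\<mu>"
    using f01 by (intro integral_nonneg_AE AE_pmfI) auto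
  \<comment> \<open>The minimizer of t^2 / 2 * M - t * \<delta>.\<close>
  define t where "t = \<delta> / M"
  have t: "0 < t" using assms by (auto simp: t_def)
  have "{xs. (\<Sum>x\<leftarrow>xs. f x) \<le> real m * (?\<mu> - \<delta>)} =
      {xs. (- t) * (\<Sum>x\<leftarrow>xs. f x) \<ge> (- t) * (real m * (?\<mu> - \<delta>))}"
    using t by simp
  then have "measure_pmf.prob (replicate_pmf m p) {xs. (\<Sum>x\<leftarrow>xs. f x) \<le> real m * (?\<mu> - \<delta>)}
      \<le> exp (real m * (exp (- t) - 1) * ?\<mu> - (- t) * (real m * (?\<mu> - \<delta>)))"
    using chernoff_replicate_pmf[where p = p and f = f and t = "- t" and m = m
      and a = "(- t) * (real m * (?\<mu> - \<delta>))", OF fin f01] by simp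
  also have "real m * (exp (- t) - 1) * ?\<mu> - (- t) * (real m * (?\<mu> - \<delta>)) =
      real m * ((exp (- t) - 1 + t) * ?\<mu> - t * \<delta>)"
    by (simp add: algebra_simps)
  also have "\<dots> \<le> real m * (t\<^sup>2 / 2 * M - t * \<delta>)"
  proof -
    have "(exp (- t) - 1 + t) * ?\<mu> \<le> t\<^sup>2 / 2 * ?\<mu>"
      using t \<mu> by (intro mult_right_mono exp_minus_taylor_bound) auto
    also have "\<dots> \<le> t\<^sup>2 / 2 * M" using M by (intro mult_left_mono) auto
    finally show ?thesis by (simp add: mult_left_mono)
  qed
  also have "t\<^sup>2 / 2 * M - t * \<delta> = - (\<delta>\<^sup>2 / (2 * M))"
    using M by (simp add: t_def field_simps power2_eq_square)
  finally show ?thesis by simp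
qed

text \<open>Splits the failure of a two-stage experiment: the first stage lands in \<open>B\<close>,
  or the second fails for a fixed good outcome of the first. It is applied with the search as first
  stage and the fresh final sample as second.\<close>

lemma prob_bind_pmf_le:
  assumes "\<And>x. x \<in> set_pmf M \<Longrightarrow> x \<notin> B \<Longrightarrow> measure_pmf.prob (f x) A \<le> c" and "0 \<le> c"
  shows "measure_pmf.prob (bind_pmf M f) A \<le> measure_pmf.prob M B + c"
proof -
  have "emeasure (bind_pmf M f) A = (\<integral>\<^sup>+x. emeasure (f x) A \<partial>M)" by simp
  also have "\<dots> \<le> (\<integral>\<^sup>+x. indicator B x + ennreal c \<partial>M)"
  proof (intro nn_integral_mono_AE AE_pmfI)
    fix x assume x: "x \<in> set_pmf M"
    show "emeasure (f x) A \<le> indicator B x + ennreal c"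
    proof (cases "x \<in> B")
      case True
      have "emeasure (f x) A \<le> 1" by (rule measure_pmf.emeasure_le_1)
      also have "\<dots> \<le> 1 + ennreal c" by simp
      finally show ?thesis using True by simp
    next
      case False
      then show ?thesis using assms(1)[OF x False]
        by (simp add: measure_pmf.emeasure_eq_measure ennreal_leI)
    qed
  qed
  also have "\<dots> = ennreal (measure_pmf.prob M B + c)"
    by (simp add: nn_integral_add measure_pmf.emeasure_eq_measure \<open>0 \<le> c\<close> ennreal_plus)
  finally have "ennreal (measure_pmf.prob (bind_pmf M f) A) \<le> ennreal (measure_pmf.prob M B + c)"
    by (simp only: measure_pmf.emeasure_eq_measure)
  then show ?thesis using \<open>0 \<le> c\<close> by (subst (asm) ennreal_le_iff) auto
qed

section \<open>Diffusion, reverse reachability and the law of the seed set\<close>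

text \<open>Once the triggering sets are fixed, diffusion is plain reachability from the seeds, and
  an RR set is the same reachability read backwards. One inclusion is by induction on time, the
  other by induction along a path from a seed.\<close>

lemma Union_active_eq:
  assumes "S \<subseteq> V"
  shows "(\<Union>t. active V T S t) = {w \<in> V. rr_set V T w \<inter> S \<noteq> {}}"
proof (intro equalityI subsetI)
  fix w assume "w \<in> (\<Union>t. active V T S t)"
  then obtain t where "w \<in> active V T S t" by blast
  then show "w \<in> {w \<in> V. rr_set V T w \<inter> S \<noteq> {}}"
  proof (induction t arbitrary: w)
    case 0
    then show ?case using assms by (auto simp: rr_set_def)
  next
    case (Suc t)
    show ?case
    proof (cases "w \<in> active V T S t")
      case True
      then show ?thesis by (rule Suc.IH)
    next
      case False
      with Suc.prems obtain u where u: "w \<in> V" "u \<in> T w" "u \<in> active V T S t" by auto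
      from Suc.IH[OF u(3)] obtain s where s: "s \<in> S" "(s, u) \<in> {(w, u). u \<in> V \<and> w \<in> T u}\<^sup>*"
        by (auto simp: rr_set_def)
      from s(2) have "s \<in> rr_set V T w"
        unfolding rr_set_def mem_Collect_eq by (rule rtrancl.rtrancl_into_rtrancl) (use u in simp)
      with s(1) u(1) show ?thesis by blast
    qed
  qed
next
  fix w assume "w \<in> {w \<in> V. rr_set V T w \<inter> S \<noteq> {}}"
  then obtain s where "s \<in> S" "(s, w) \<in> {(w, u). u \<in> V \<and> w \<in> T u}\<^sup>*"
    by (auto simp: rr_set_def)
  from this(2) show "w \<in> (\<Union>t. active V T S t)"
  proof (induction rule: rtrancl_induct)
    case base
    have "s \<in> active V T S 0" using \<open>s \<in> S\<close> by simp
    then show ?case by blast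
  next
    case (step u w)
    from step.IH obtain t where "u \<in> active V T S t" by blast
    with step.hyps(2) have "w \<in> active V T S (Suc t)" by auto
    then show ?case by blast
  qed
qed

lemma rr_set_subset:
  assumes "v \<in> V" and T: "\<And>u. u \<in> V \<Longrightarrow> T u \<subseteq> V"
  shows "rr_set V T v \<subseteq> V"
proof
  fix w assume "w \<in> rr_set V T v"
  then have "(w, v) \<in> {(w, u). u \<in> V \<and> w \<in> T u}\<^sup>*" by (simp add: rr_set_def)
  then show "w \<in> V"
    by (induction rule: converse_rtrancl_induct) (use assms in auto)
qed

text \<open>The product is the weight of S when each u joins the seed set independently with
  probability h u, so this is the probability that the seed set meets R, obtained through the
  complementary event.\<close>

lemma sum_hitting_weights:
  fixes h :: "'a \<Rightarrow> real"
  assumes "finite V" "R \<subseteq> V"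
  shows "(\<Sum>S\<in>Pow V. of_bool (R \<inter> S \<noteq> {}) * ((\<Prod>u\<in>S. h u) * (\<Prod>v\<in>V - S. 1 - h v)))
    = 1 - (\<Prod>v\<in>R. 1 - h v)"
proof -
  let ?w = "\<lambda>S. (\<Prod>u\<in>S. h u) * (\<Prod>v\<in>V - S. 1 - h v)"
  \<comment> \<open>With h set to 0 on R, the product expansion loses exactly the terms whose S
    meets R, while the factor at v becomes 1 - h v on R and 1 elsewhere.\<close>
  let ?h0 = "\<lambda>v. if v \<in> R then 0 else h v"
  have total: "(\<Sum>S\<in>Pow V. ?w S) = 1"
    using prod_add[OF assms(1), of h "\<lambda>v. 1 - h v"] by simp
  have "(\<Prod>v\<in>R. 1 - h v) = (\<Prod>v\<in>V. ?h0 v + (1 - h v))"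
    using assms by (intro prod.mono_neutral_cong_left) auto
  also have "\<dots> = (\<Sum>S\<in>Pow V. (\<Prod>u\<in>S. ?h0 u) * (\<Prod>v\<in>V - S. 1 - h v))"
    by (rule prod_add[OF assms(1)])
  also have "\<dots> = (\<Sum>S\<in>Pow V. of_bool (R \<inter> S = {}) * ?w S)"
  proof (rule sum.cong[OF refl])
    fix S assume "S \<in> Pow V"
    then have fin: "finite S" using assms(1) finite_subset by blast
    have "(\<Prod>u\<in>S. ?h0 u) = of_bool (R \<inter> S = {}) * (\<Prod>u\<in>S. h u)"
    proof (cases "R \<inter> S = {}")
      case True
      then show ?thesis by (auto intro!: prod.cong)
    next
      case False
      then have "\<exists>u\<in>S. ?h0 u = 0" by auto
      with fin have "(\<Prod>u\<in>S. ?h0 u) = 0" by (rule prod_zero)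
      with False show ?thesis by simp
    qed
    then show "(\<Prod>u\<in>S. ?h0 u) * (\<Prod>v\<in>V - S. 1 - h v) = of_bool (R \<inter> S = {}) * ?w S"
      by simp
  qed
  finally have "(\<Sum>S\<in>Pow V. of_bool (R \<inter> S = {}) * ?w S) = (\<Prod>v\<in>R. 1 - h v)" ..
  moreover have "(\<Sum>S\<in>Pow V. of_bool (R \<inter> S \<noteq> {}) * ?w S) =
      (\<Sum>S\<in>Pow V. ?w S) - (\<Sum>S\<in>Pow V. of_bool (R \<inter> S = {}) * ?w S)"
    unfolding sum_subtractf[symmetric] by (rule sum.cong) auto
  ultimately show ?thesis using total by simp
qed

section \<open>Coverage of an RR set, one-sided distance and nets\<close>

text \<open>By \<open>sum_hitting_weights\<close>, the chance that the random seed set at mix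
  \<open>x\<close> meets \<open>R\<close>. Up to the factor n, its mean is g and its empirical mean
  is g_hat, so this is the variable to which the tail bounds apply.\<close>

definition coverage :: "('v, 'd::finite, 'z) cim_bs_scheme \<Rightarrow> real ^ 'd \<Rightarrow> 'v set \<Rightarrow> real" where
  "coverage I x R = 1 - (\<Prod>v\<in>R. 1 - act I v x)"

lemma g_hat_coverage:
  "g_hat I Rs x = num_verts I / real (length Rs) * (\<Sum>R\<leftarrow>Rs. coverage I x R)"
  by (simp add: g_hat_def coverage_def)

text \<open>For a coordinatewise monotone function only the coordinates in which \<open>x\<close>
  exceeds \<open>y\<close> can raise the value from \<open>y\<close> to \<open>x\<close>. The two
  one-sided distances together make up a single l1 distance.\<close>

definition pos_dist :: "real ^ 'd::finite \<Rightarrow> real ^ 'd \<Rightarrow> real" where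
  "pos_dist x y = (\<Sum>j\<in>UNIV. max 0 (x $ j - y $ j))"

lemma pos_dist_nonneg: "0 \<le> pos_dist x y"
  by (simp add: pos_dist_def sum_nonneg)

lemma sum_abs_le_sqrt_norm: "(\<Sum>j\<in>UNIV. \<bar>z $ j\<bar>) \<le> sqrt (real CARD('d)) * norm (z :: real ^ 'd::finite)"
proof -
  have "(\<Sum>j\<in>UNIV. \<bar>z $ j\<bar> * \<bar>1\<bar>) \<le> L2_set (\<lambda>j. z $ j) UNIV * L2_set (\<lambda>_. 1) (UNIV :: 'd set)"
    by (rule L2_set_mult_ineq)
  also have "\<dots> = norm z * sqrt (real CARD('d))"
    by (simp add: norm_vec_def L2_set_def)
  finally show ?thesis by (simp add: mult.commute)
qed

lemma pos_dist_add_le: "pos_dist x y + pos_dist y x \<le> sqrt (real CARD('d)) * norm (x - y)"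
  for x y :: "real ^ 'd::finite"
proof -
  have "pos_dist x y + pos_dist y x = (\<Sum>j\<in>UNIV. \<bar>(x - y) $ j\<bar>)"
    unfolding pos_dist_def sum.distrib[symmetric] by (intro sum.cong) (auto simp: max_def)
  then show ?thesis using sum_abs_le_sqrt_norm[of "x - y"] by simp
qed

text \<open>The nets counted by \<^const>\<open>covering_number\<close> may leave \<^term>\<open>S\<close>; projecting
  them onto the convex set \<^term>\<open>S\<close> keeps both cardinality and radius.\<close>

lemma ex_net_card_le_covering_number:
  fixes S :: "'a::euclidean_space set"
  assumes S: "convex S" "compact S" "S \<noteq> {}" and "0 < r"
  obtains N where "N \<subseteq> S" "finite N" "0 < card N" "card N \<le> covering_number S r"
    "\<And>x. x \<in> S \<Longrightarrow> \<exists>y\<in>N. dist x y \<le> r"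
proof -
  \<comment> \<open>Total boundedness provides some finite net, so the LEAST in
    \<open>covering_number\<close> is attained and not an arbitrary value.\<close>
  from S(2) \<open>0 < r\<close> obtain K where "finite K" "S \<subseteq> (\<Union>x\<in>K. ball x r)"
    using compact_eq_totally_bounded by metis
  then have "is_net S r K"
    unfolding is_net_def by (force simp: dist_commute less_imp_le)
  then have "\<exists>m N. is_net S r N \<and> card N = m" by blast
  then have "\<exists>N. is_net S r N \<and> card N = covering_number S r"
    unfolding covering_number_def by (rule LeastI_ex)
  then obtain N where N: "finite N" "card N = covering_number S r"
    "\<And>x. x \<in> S \<Longrightarrow> \<exists>y\<in>N. dist x y \<le> r"
    by (auto simp: is_net_def)
  have closed: "closed S" using S(2) by (rule compact_imp_closed)
  have sub: "closest_point S ` N \<subseteq> S"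
    using closest_point_in_set[OF closed S(3)] by blast
  have net: "\<exists>y\<in>closest_point S ` N. dist x y \<le> r" if "x \<in> S" for x
  proof -
    from N(3)[OF that] obtain y where "y \<in> N" "dist x y \<le> r" by blast
    moreover have "dist x (closest_point S y) \<le> dist x y"
      using closest_point_lipschitz[OF S(1) closed S(3), of x y] closest_point_self[OF that] by simp
    ultimately show ?thesis by force
  qed
  have "card (closest_point S ` N) \<le> covering_number S r"
    using card_image_le[OF N(1), of "closest_point S"] N(2) by simp
  moreover have "closest_point S ` N \<noteq> {}" using net S(3) by blast
  ultimately show thesis using that[of "closest_point S ` N"] sub net N(1)
    by (simp add: card_gt_0_iff)
qed

section \<open>Lipschitz estimates and unbiasedness of RR sets\<close>

locale cim_bs_instance =
  fixes I :: "('v, 'd::finite) ris_input"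
  assumes finite_verts: "finite (verts I)" and verts_nonempty: "verts I \<noteq> {}"
    and edges_subset: "edges I \<subseteq> verts I \<times> verts I"
    and trig_support: "\<And>v. v \<in> verts I \<Longrightarrow> set_pmf (trig I v) \<subseteq> Pow {u. (u, v) \<in> edges I}"
    and convex_mixes: "convex (mixes I)" and mixes_nonneg: "mixes I \<subseteq> nonneg_orthant"
    and saving_wt_nonneg: "saving_wt I \<ge> 0"
    and feasible_nonempty: "feasible I \<noteq> {}" and feasible_closed: "closed (feasible I)"
    and feasible_diam:
      "\<And>x y. x \<in> feasible I \<Longrightarrow> y \<in> feasible I \<Longrightarrow> norm (x - y) \<le> diam_bd I"
    and act_eq: "\<And>v x. v \<in> verts I \<Longrightarrow> x \<in> nonneg_orthant \<Longrightarrow>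
           act I v x = 1 - (\<Prod>j\<in>UNIV. 1 - strat_act I v j (x $ j))"
    and strat_act_range: "\<And>v j. v \<in> verts I \<Longrightarrow> strat_act I v j ` {0..} \<subseteq> {0..1}"
    and strat_act_mono: "\<And>v j. v \<in> verts I \<Longrightarrow> mono_on {0..} (strat_act I v j)"
    and strat_act_lipschitz:
      "\<And>v j. v \<in> verts I \<Longrightarrow> (lip_q I)-lipschitz_on {0..} (strat_act I v j)"
    and cost_convex: "convex_on (mixes I) (cost I)"
    and cost_lipschitz: "(lip_c I)-lipschitz_on (mixes I) (cost I)"
    and start_feasible: "start I \<in> feasible I"
    and sgrad_q: "\<And>v j a. v \<in> verts I \<Longrightarrow> a \<ge> 0 \<Longrightarrow>
           supergradient_on {0..} (strat_act I v j) a (sgrad_q I v j a) \<and>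
           norm (sgrad_q I v j a) \<le> lip_q I"
    and sgrad_s: "\<And>x. x \<in> feasible I \<Longrightarrow>
           supergradient_on (feasible I) (saving I) x (sgrad_s I x) \<and>
           norm (sgrad_s I x) \<le> saving_wt I * lip_c I"
    and opt_ge_1: "opt_value I \<ge> 1"
begin

lemma num_verts_ge_1: "1 \<le> num_verts I"
  using finite_verts verts_nonempty by (simp add: Suc_le_eq card_gt_0_iff)

lemma lip_q_nonneg: "0 \<le> lip_q I"
  using verts_nonempty strat_act_lipschitz lipschitz_on_nonneg by blast

lemma lip_c_nonneg: "0 \<le> lip_c I"
  using cost_lipschitz lipschitz_on_nonneg by blast

lemma feasible_nonneg: "x \<in> feasible I \<Longrightarrow> x \<in> nonneg_orthant"
  using mixes_nonneg by (auto simp: feasible_def)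

lemma feasible_convex: "convex (feasible I)"
proof (rule convexI)
  fix x y :: "real ^ 'd" and a b :: real
  assume xy: "x \<in> feasible I" "y \<in> feasible I" and ab: "0 \<le> a" "0 \<le> b" "a + b = 1"
  have "cost I (a *\<^sub>R x + b *\<^sub>R y) \<le> a * cost I x + b * cost I y"
    using cost_convex xy ab by (simp add: convex_on_def feasible_def)
  also have "\<dots> \<le> budget I"
    using xy ab by (intro convex_bound_le) (auto simp: feasible_def)
  finally show "a *\<^sub>R x + b *\<^sub>R y \<in> feasible I"
    using convexD[OF convex_mixes _ _ ab] xy by (simp add: feasible_def)
qed

lemma feasible_compact: "compact (feasible I)"
proof -
  obtain a where "a \<in> feasible I" using feasible_nonempty by blast
  then have "feasible I \<subseteq> cball a (diam_bd I)"
    using feasible_diam by (auto simp: dist_norm)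
  then have "bounded (feasible I)" using bounded_cball bounded_subset by blast
  with feasible_closed show ?thesis by (simp add: compact_eq_bounded_closed)
qed

lemma strat_act_bounds:
  assumes "v \<in> verts I" "0 \<le> a"
  shows "0 \<le> strat_act I v j a" "strat_act I v j a \<le> 1"
  using strat_act_range[OF assms(1), of j] assms(2) by (auto simp: image_subset_iff)

lemma act_bounds:
  assumes "v \<in> verts I" "x \<in> nonneg_orthant"
  shows "0 \<le> act I v x" "act I v x \<le> 1"
  unfolding act_eq[OF assms] using strat_act_bounds[OF assms(1)] assms(2)
  by (auto intro!: prod_le_1 prod_nonneg)

lemma coverage_bounds:
  assumes "R \<subseteq> verts I" "x \<in> nonneg_orthant"
  shows "0 \<le> coverage I x R" "coverage I x R \<le> 1"
  unfolding coverage_def using act_bounds assms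
  by (auto intro!: prod_le_1 prod_nonneg simp: subset_iff)

lemma coverage_mono:
  assumes R: "R \<subseteq> verts I" and x: "x \<in> nonneg_orthant" and le: "\<And>j. x $ j \<le> y $ j"
  shows "coverage I x R \<le> coverage I y R"
proof -
  have y: "y \<in> nonneg_orthant" using x le order_trans by (auto; blast)
  have "(\<Prod>v\<in>R. 1 - act I v y) \<le> (\<Prod>v\<in>R. 1 - act I v x)"
  proof (rule prod_mono)
    fix v assume "v \<in> R"
    then have v: "v \<in> verts I" using R by blast
    have "(\<Prod>j\<in>UNIV. 1 - strat_act I v j (y $ j)) \<le> (\<Prod>j\<in>UNIV. 1 - strat_act I v j (x $ j))"
      using strat_act_bounds[OF v] mono_onD[OF strat_act_mono[OF v]] x y le
      by (intro prod_mono) auto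
    then show "0 \<le> 1 - act I v y \<and> 1 - act I v y \<le> 1 - act I v x"
      using act_bounds[OF v y] by (simp add: act_eq[OF v x] act_eq[OF v y])
  qed
  then show ?thesis by (simp add: coverage_def)
qed

text \<open>Replacing \<open>x\<close> by the join of \<open>x\<close> and \<open>y\<close> can only
  increase the coverage and leaves just the positive parts of x - y. The rest is the telescoping
  bound for products of numbers of absolute value at most 1, used once over the nodes of
  \<open>R\<close> and once over the strategies.\<close>

lemma coverage_diff_le:
  assumes R: "R \<subseteq> verts I" and x: "x \<in> nonneg_orthant" and y: "y \<in> nonneg_orthant"
  shows "coverage I x R - coverage I y R \<le> num_verts I * lip_q I * pos_dist x y"
proof -
  define u where "u = (\<chi> j. max (x $ j) (y $ j))"
  have u: "u \<in> nonneg_orthant" using x by (auto simp: u_def le_max_iff_disj)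
  have "coverage I x R - coverage I y R \<le> coverage I u R - coverage I y R"
    using coverage_mono[OF R x, of u] by (simp add: u_def)
  also have "\<dots> \<le> norm ((\<Prod>v\<in>R. 1 - act I v y) - (\<Prod>v\<in>R. 1 - act I v u))"
    by (simp add: coverage_def)
  also have "\<dots> \<le> (\<Sum>v\<in>R. norm ((1 - act I v y) - (1 - act I v u)))"
    using act_bounds R u y by (intro norm_prod_diff) (auto simp: subset_iff abs_le_iff)
  also have "\<dots> \<le> (\<Sum>v\<in>R. lip_q I * pos_dist x y)"
  proof (rule sum_mono)
    fix v assume "v \<in> R"
    then have v: "v \<in> verts I" using R by blast
    have "norm ((1 - act I v y) - (1 - act I v u)) =
        norm ((\<Prod>j\<in>UNIV. 1 - strat_act I v j (y $ j)) - (\<Prod>j\<in>UNIV. 1 - strat_act I v j (u $ j)))"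
      unfolding act_eq[OF v u] act_eq[OF v y] by simp
    also have "\<dots> \<le> (\<Sum>j\<in>UNIV. norm ((1 - strat_act I v j (y $ j)) - (1 - strat_act I v j (u $ j))))"
      using strat_act_bounds[OF v] u y by (intro norm_prod_diff) (auto simp: abs_le_iff)
    also have "\<dots> \<le> (\<Sum>j\<in>UNIV. lip_q I * max 0 (x $ j - y $ j))"
    proof (rule sum_mono)
      fix j
      have "norm ((1 - strat_act I v j (y $ j)) - (1 - strat_act I v j (u $ j))) =
          dist (strat_act I v j (u $ j)) (strat_act I v j (y $ j))"
        by (simp add: dist_real_def)
      also have "\<dots> \<le> lip_q I * dist (u $ j) (y $ j)"
        using u y by (intro lipschitz_onD[OF strat_act_lipschitz[OF v]]) auto
      also have "dist (u $ j) (y $ j) = max 0 (x $ j - y $ j)"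
        by (auto simp: u_def dist_real_def max_def)
      finally show "norm ((1 - strat_act I v j (y $ j)) - (1 - strat_act I v j (u $ j)))
          \<le> lip_q I * max 0 (x $ j - y $ j)" .
    qed
    finally show "norm ((1 - act I v y) - (1 - act I v u)) \<le> lip_q I * pos_dist x y"
      by (simp add: pos_dist_def sum_distrib_left)
  qed
  also have "\<dots> = real (card R) * (lip_q I * pos_dist x y)" by simp
  also have "\<dots> \<le> num_verts I * (lip_q I * pos_dist x y)"
    using card_mono[OF finite_verts R] lip_q_nonneg pos_dist_nonneg[of x y]
    by (intro mult_right_mono) auto
  finally show ?thesis by (simp add: mult.assoc)
qed

lemma set_trigger_sets:
  assumes "T \<in> set_pmf (trigger_sets I)" "u \<in> verts I"
  shows "T u \<subseteq> verts I"
proof -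
  have "T u \<in> set_pmf (trig I u)"
    using assms finite_verts by (auto simp: trigger_sets_def set_Pi_pmf PiE_dflt_def)
  then show ?thesis using trig_support[OF assms(2)] edges_subset by blast
qed

lemma finite_trigger_sets: "finite (set_pmf (trigger_sets I))"
proof -
  have "set_pmf (trig I v) \<subseteq> Pow (verts I)" if "v \<in> verts I" for v
    using trig_support[OF that] edges_subset by blast
  then have "finite (set_pmf (trig I v))" if "v \<in> verts I" for v
    using that finite_verts finite_subset by (metis finite_Pow_iff)
  then show ?thesis
    using finite_verts by (auto simp: trigger_sets_def set_Pi_pmf intro!: finite_PiE_dflt)
qed

lemma finite_rr_pmf: "finite (set_pmf (rr_pmf I))"
  using finite_verts verts_nonempty finite_trigger_sets by (simp add: rr_pmf_def)

lemma set_rr_pmf: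
  assumes "R \<in> set_pmf (rr_pmf I)"
  shows "R \<subseteq> verts I"
proof -
  from assms obtain v T where "v \<in> verts I" "T \<in> set_pmf (trigger_sets I)" "R = rr_set (verts I) T v"
    using finite_verts verts_nonempty by (auto simp: rr_pmf_def)
  then show ?thesis using rr_set_subset[of v "verts I" T] set_trigger_sets by blast
qed

lemma set_replicate_rr_pmf:
  assumes "Rs \<in> set_pmf (replicate_pmf m (rr_pmf I))" "R \<in> set Rs"
  shows "R \<subseteq> verts I"
  using assms set_rr_pmf by (auto simp: set_replicate_pmf in_lists_conv_set)

text \<open>The sum over seed sets is moved inside the expectation over triggering sets. For fixed
  triggering sets a node ends up active iff its RR set meets the seed set, so summing over seed sets
  gives the coverage of that RR set; the factor n cancels the 1/n of the uniform root.\<close>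

lemma influence_eq_expectation:
  "influence I x = num_verts I * measure_pmf.expectation (rr_pmf I) (coverage I x)"
proof -
  let ?E = "measure_pmf.expectation (trigger_sets I)"
  let ?w = "\<lambda>S. (\<Prod>u\<in>S. act I u x) * (\<Prod>v\<in>verts I - S. 1 - act I v x)"
  note int = integrable_measure_pmf_finite[OF finite_trigger_sets]
  have "influence I x = (\<Sum>S\<in>Pow (verts I). ?E (\<lambda>T.
      (\<Sum>v\<in>verts I. of_bool (rr_set (verts I) T v \<inter> S \<noteq> {})) * ?w S))"
    unfolding influence_def spread_def
  proof (rule sum.cong[OF refl])
    fix S assume "S \<in> Pow (verts I)"
    then have "real (card (\<Union>t. active (verts I) T S t)) =
        (\<Sum>v\<in>verts I. of_bool (rr_set (verts I) T v \<inter> S \<noteq> {}))" for T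
      using finite_verts by (simp add: Union_active_eq sum_of_bool_eq Collect_conj_eq)
    then show "?E (\<lambda>T. real (card (\<Union>t. active (verts I) T S t))) * (\<Prod>u\<in>S. act I u x) *
        (\<Prod>v\<in>verts I - S. 1 - act I v x) =
      ?E (\<lambda>T. (\<Sum>v\<in>verts I. of_bool (rr_set (verts I) T v \<inter> S \<noteq> {})) * ?w S)"
      by (simp add: mult.assoc)
  qed
  also have "\<dots> = ?E (\<lambda>T. \<Sum>v\<in>verts I. \<Sum>S\<in>Pow (verts I).
      of_bool (rr_set (verts I) T v \<inter> S \<noteq> {}) * ?w S)"
    by (subst Bochner_Integration.integral_sum[symmetric])
       (auto intro: int simp: sum_distrib_right intro!: sum.swap Bochner_Integration.integral_cong)
  also have "\<dots> = ?E (\<lambda>T. \<Sum>v\<in>verts I. coverage I x (rr_set (verts I) T v))"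
    unfolding coverage_def
    by (intro integral_cong_AE AE_pmfI sum.cong refl sum_hitting_weights finite_verts
        rr_set_subset set_trigger_sets) auto
  also have "\<dots> = (\<Sum>v\<in>verts I. ?E (\<lambda>T. coverage I x (rr_set (verts I) T v)))"
    by (intro Bochner_Integration.integral_sum int)
  also have "\<dots> = num_verts I * measure_pmf.expectation (rr_pmf I) (coverage I x)"
  proof -
    have "measure_pmf.expectation (rr_pmf I) (coverage I x) =
      (\<Sum>v\<in>verts I. ?E (\<lambda>T. coverage I x (rr_set (verts I) T v)) / num_verts I)"
      unfolding rr_pmf_def
      by (subst pmf_expectation_bind_pmf_of_set)
         (auto simp: finite_verts verts_nonempty finite_trigger_sets map_pmf_def[symmetric] divide_inverse mult.commute)
    then show ?thesis
      using num_verts_ge_1 by (simp add: sum_divide_distrib[symmetric])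
  qed
  finally show ?thesis .
qed

lemma influence_nonneg:
  assumes "x \<in> nonneg_orthant"
  shows "0 \<le> influence I x"
  unfolding influence_eq_expectation
  using coverage_bounds(1)[OF set_rr_pmf assms] by (intro mult_nonneg_nonneg integral_nonneg_AE AE_pmfI) auto

lemma influence_diff_le:
  assumes "x \<in> nonneg_orthant" "y \<in> nonneg_orthant"
  shows "influence I x - influence I y \<le> (num_verts I)\<^sup>2 * lip_q I * pos_dist x y"
proof -
  note int = integrable_measure_pmf_finite[OF finite_rr_pmf]
  have "measure_pmf.expectation (rr_pmf I) (coverage I x) - measure_pmf.expectation (rr_pmf I) (coverage I y)
    = measure_pmf.expectation (rr_pmf I) (\<lambda>R. coverage I x R - coverage I y R)"
    by (subst Bochner_Integration.integral_diff) (auto intro: int)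
  also have "\<dots> \<le> measure_pmf.expectation (rr_pmf I) (\<lambda>_. num_verts I * lip_q I * pos_dist x y)"
    using coverage_diff_le[OF set_rr_pmf assms] by (intro integral_mono_AE int AE_pmfI)
  finally show ?thesis
    using num_verts_ge_1
    by (simp add: influence_eq_expectation right_diff_distrib[symmetric] power2_eq_square mult.assoc mult_left_mono)
qed

lemma g_hat_diff_le:
  assumes Rs: "\<And>R. R \<in> set Rs \<Longrightarrow> R \<subseteq> verts I"
    and x: "x \<in> nonneg_orthant" and y: "y \<in> nonneg_orthant"
  shows "g_hat I Rs x - g_hat I Rs y \<le> (num_verts I)\<^sup>2 * lip_q I * pos_dist x y"
proof (cases "Rs = []")
  case True
  then show ?thesis using lip_q_nonneg pos_dist_nonneg[of x y] by (simp add: g_hat_def)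
next
  case False
  have "g_hat I Rs x - g_hat I Rs y =
      num_verts I / real (length Rs) * (\<Sum>R\<leftarrow>Rs. coverage I x R - coverage I y R)"
    by (simp add: g_hat_coverage sum_list_subtractf right_diff_distrib)
  also have "\<dots> \<le> num_verts I / real (length Rs) *
      (real (length Rs) * (num_verts I * lip_q I * pos_dist x y))"
    using coverage_diff_le[OF Rs x y] by (intro mult_left_mono sum_list_mono_bound) auto
  also have "\<dots> = (num_verts I)\<^sup>2 * lip_q I * pos_dist x y"
    using False by (simp add: power2_eq_square)
  finally show ?thesis .
qed

lemma saving_nonneg: "x \<in> feasible I \<Longrightarrow> 0 \<le> saving I x"
  using saving_wt_nonneg by (simp add: saving_def feasible_def)

lemma saving_diff_le:
  assumes "x \<in> feasible I" "y \<in> feasible I"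
  shows "saving I x - saving I y \<le> saving_wt I * lip_c I * norm (x - y)"
proof -
  have "cost I y - cost I x \<le> lip_c I * norm (x - y)"
    using lipschitz_onD[OF cost_lipschitz, of x y] assms
    by (auto simp: feasible_def dist_norm)
  then have "saving_wt I * (cost I y - cost I x) \<le> saving_wt I * (lip_c I * norm (x - y))"
    using saving_wt_nonneg by (rule mult_left_mono)
  then show ?thesis by (simp add: saving_def algebra_simps)
qed

lemma pos_dist_le: "(num_verts I)\<^sup>2 * lip_q I * (pos_dist x y + pos_dist y x) \<le>
    (num_verts I)\<^sup>2 * sqrt (real CARD('d)) * lip_q I * norm (x - y)" for x y :: "real ^ 'd"
  using mult_left_mono[OF pos_dist_add_le[of x y], of "(num_verts I)\<^sup>2 * lip_q I"] lip_q_nonneg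
  by (simp add: mult_ac)

lemma global_lip_nonneg: "0 \<le> global_lip I"
  using lip_q_nonneg lip_c_nonneg saving_wt_nonneg by (simp add: global_lip_def)

lemma saving_lip_nonneg: "0 \<le> saving_wt I * lip_c I * norm (x - y)"
  using lip_c_nonneg saving_wt_nonneg by simp

lemma influence_diff_le_norm:
  assumes "x \<in> nonneg_orthant" "y \<in> nonneg_orthant"
  shows "influence I x - influence I y \<le> global_lip I * norm (x - y)"
proof -
  have "influence I x - influence I y \<le> (num_verts I)\<^sup>2 * lip_q I * (pos_dist x y + pos_dist y x)"
    using influence_diff_le[OF assms] pos_dist_nonneg[of y x] lip_q_nonneg
    by (intro order_trans[OF influence_diff_le[OF assms]] mult_left_mono) auto
  also note pos_dist_le
  finally show ?thesis using saving_lip_nonneg[of x y] by (simp add: global_lip_def distrib_right)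
qed

lemma g_hat_saving_diff_le:
  assumes "\<And>R. R \<in> set Rs \<Longrightarrow> R \<subseteq> verts I" and x: "x \<in> feasible I" and y: "y \<in> feasible I"
  shows "(g_hat I Rs x + saving I x) - (g_hat I Rs y + saving I y) \<le> global_lip I * norm (x - y)"
proof -
  have "g_hat I Rs x - g_hat I Rs y \<le> (num_verts I)\<^sup>2 * lip_q I * (pos_dist x y + pos_dist y x)"
    using pos_dist_nonneg[of y x] lip_q_nonneg x y
    by (intro order_trans[OF g_hat_diff_le[OF assms(1)]] mult_left_mono feasible_nonneg) auto
  also note pos_dist_le
  finally show ?thesis using saving_diff_le[OF x y] by (simp add: global_lip_def distrib_right)
qed

text \<open>Both functions are monotone, so in each coordinate their increments have the same sign;
  hence the difference has the Lipschitz constant of a single one of them, not twice that.\<close>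

lemma g_hat_minus_influence_diff_le:
  assumes "\<And>R. R \<in> set Rs \<Longrightarrow> R \<subseteq> verts I" and "x \<in> nonneg_orthant" "y \<in> nonneg_orthant"
  shows "(g_hat I Rs x - influence I x) - (g_hat I Rs y - influence I y) \<le>
    global_lip I * norm (x - y)"
proof -
  have "(g_hat I Rs x - influence I x) - (g_hat I Rs y - influence I y) \<le>
      (num_verts I)\<^sup>2 * lip_q I * (pos_dist x y + pos_dist y x)"
    using g_hat_diff_le[of Rs x y, OF assms] influence_diff_le[OF assms(3,2)]
    unfolding distrib_left by linarith
  also note pos_dist_le
  finally show ?thesis using saving_lip_nonneg[of x y] by (simp add: global_lip_def distrib_right)
qed

lemma objective_diff_le:
  assumes x: "x \<in> feasible I" and y: "y \<in> feasible I"
  shows "(influence I x + saving I x) - (influence I y + saving I y) \<le> global_lip I * norm (x - y)"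
proof -
  have "influence I x - influence I y \<le> (num_verts I)\<^sup>2 * lip_q I * (pos_dist x y + pos_dist y x)"
    using pos_dist_nonneg[of y x] lip_q_nonneg x y
    by (intro order_trans[OF influence_diff_le] mult_left_mono feasible_nonneg) auto
  also note pos_dist_le
  finally show ?thesis using saving_diff_le[OF x y] by (simp add: global_lip_def distrib_right)
qed

text \<open>A Lipschitz function on a compact set attains its supremum, so the SUP in
  \<open>opt_value\<close> is a genuine maximum.\<close>

lemma objective_maximizer:
  obtains x where "x \<in> feasible I" "influence I x + saving I x = opt_value I"
    "\<And>y. y \<in> feasible I \<Longrightarrow> influence I y + saving I y \<le> opt_value I"
proof -
  let ?f = "\<lambda>x. influence I x + saving I x"
  have "(global_lip I)-lipschitz_on (feasible I) ?f"
  proof (rule lipschitz_onI[OF _ global_lip_nonneg])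
    fix x y assume "x \<in> feasible I" "y \<in> feasible I"
    then show "dist (?f x) (?f y) \<le> global_lip I * dist x y"
      using objective_diff_le[of x y] objective_diff_le[of y x]
      by (simp add: dist_real_def dist_norm norm_minus_commute)
  qed
  then have "continuous_on (feasible I) ?f" by (rule lipschitz_on_continuous_on)
  from continuous_attains_sup[OF feasible_compact feasible_nonempty this]
  obtain x where x: "x \<in> feasible I" "\<And>y. y \<in> feasible I \<Longrightarrow> ?f y \<le> ?f x" by blast
  have "opt_value I = ?f x"
    unfolding opt_value_def using x by (intro cSup_eq_maximum) auto
  with x that show thesis by metis
qed

end

section \<open>Product bounds, the projected supergradient method and the inner algorithm\<close>

text \<open>Telescoping: changing one factor from 1 to 1 - a i moves a product of factors in [0, 1]
  by at most a i.\<close>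

lemma one_minus_prod_le:
  fixes a :: "'a \<Rightarrow> real"
  assumes "\<And>i. i \<in> A \<Longrightarrow> 0 \<le> a i \<and> a i \<le> 1"
  shows "1 - (\<Prod>i\<in>A. 1 - a i) \<le> min 1 (\<Sum>i\<in>A. a i)"
proof -
  have "1 - (\<Prod>i\<in>A. 1 - a i) \<le> norm ((\<Prod>i\<in>A. 1) - (\<Prod>i\<in>A. 1 - a i))" by simp
  also have "\<dots> \<le> (\<Sum>i\<in>A. norm (1 - (1 - a i)))"
    using assms by (intro norm_prod_diff) auto
  also have "\<dots> = (\<Sum>i\<in>A. a i)" using assms by (intro sum.cong) auto
  finally show ?thesis using assms by (auto intro!: prod_nonneg)
qed

text \<open>Bounding each factor by exp (- a i) reduces the claim to the scalar inequality
  \<open>one_minus_exp_ge_min\<close> at the sum.\<close>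

lemma one_minus_prod_ge:
  fixes a :: "'a \<Rightarrow> real"
  assumes "finite A" "\<And>i. i \<in> A \<Longrightarrow> 0 \<le> a i \<and> a i \<le> 1"
  shows "alpha * min 1 (\<Sum>i\<in>A. a i) \<le> 1 - (\<Prod>i\<in>A. 1 - a i)"
proof -
  have "(\<Prod>i\<in>A. 1 - a i) \<le> (\<Prod>i\<in>A. exp (- a i))"
  proof (rule prod_mono)
    fix i assume "i \<in> A"
    then show "0 \<le> 1 - a i \<and> 1 - a i \<le> exp (- a i)"
      using assms(2)[of i] exp_ge_add_one_self[of "- a i"] by auto
  qed
  also have "\<dots> = exp (- (\<Sum>i\<in>A. a i))"
    using assms(1) by (simp add: exp_sum sum_negf[symmetric])
  finally show ?thesis
    using one_minus_exp_ge_min[of "\<Sum>i\<in>A. a i"] assms by (simp add: sum_nonneg)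
qed

lemma arg_max_on_finite:
  fixes f :: "'a \<Rightarrow> real"
  assumes "finite S" "S \<noteq> {}"
  shows "arg_max_on f S \<in> S" "\<And>y. y \<in> S \<Longrightarrow> f y \<le> f (arg_max_on f S)"
proof -
  have "Max (f ` S) \<in> f ` S" using assms by (intro Max_in) auto
  then obtain x where x: "x \<in> S" "f x = Max (f ` S)" by auto
  then have max: "f y \<le> f x" if "y \<in> S" for y using assms that by simp
  have "arg_max_on f S \<in> S \<and> (\<forall>y\<in>S. f y \<le> f (arg_max_on f S))"
    unfolding arg_max_on_def
    by (rule arg_maxI[where x = x]) (use x(1) max in \<open>force simp: not_less\<close>)+
  then show "arg_max_on f S \<in> S" "\<And>y. y \<in> S \<Longrightarrow> f y \<le> f (arg_max_on f S)" by auto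
qed

lemma projected_supergradient_regret:
  fixes z w :: "nat \<Rightarrow> 'a::euclidean_space" and f :: "'a \<Rightarrow> real"
  assumes S: "convex S" "closed S" and D: "0 < D" and L: "0 < L"
    and diam: "\<And>x y. x \<in> S \<Longrightarrow> y \<in> S \<Longrightarrow> norm (x - y) \<le> D"
    and z: "\<And>t. z t \<in> S"
    and step: "\<And>t. z (Suc t) = closest_point S (z t + (D / (L * sqrt (real (Suc t)))) *\<^sub>R w t)"
    and super: "\<And>t. supergradient_on S f (z t) (w t)" and norm_w: "\<And>t. norm (w t) \<le> L"
    and y: "y \<in> S"
  \<comment> \<open>The term with \<^term>\<open>z T\<close> is what makes the bound inductive.\<close>
  shows "(\<Sum>t<T. f y - f (z t)) \<le>
    L / (2 * D) * sqrt (real T) * (D\<^sup>2 - (norm (z T - y))\<^sup>2) + L * D * sqrt (real T)"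
proof (induction T)
  case (Suc T)
  define s where "s = sqrt (real (Suc T))"
  define \<eta> where "\<eta> = D / (L * s)"
  have s: "0 < s" "sqrt (real T) \<le> s" by (simp_all add: s_def)
  have \<eta>: "0 < \<eta>" using s D L by (simp add: \<eta>_def)
  have "f y - f (z T) \<le> w T \<bullet> (y - z T)"
    using super[of T] y by (auto simp: supergradient_on_def algebra_simps)
  \<comment> \<open>Projection onto a closed convex set is nonexpansive and fixes \<open>y\<close>,
    so it does not increase the distance to \<open>y\<close>.\<close>
  moreover have "norm (z (Suc T) - y) \<le> norm (z T + \<eta> *\<^sub>R w T - y)"
    using closest_point_lipschitz[OF S, of "z T + \<eta> *\<^sub>R w T" y] y closest_point_self[OF y]
    by (auto simp: step \<eta>_def s_def dist_norm)
  then have "(norm (z (Suc T) - y))\<^sup>2 \<le> (norm ((z T - y) + \<eta> *\<^sub>R w T))\<^sup>2"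
    by (intro power_mono) (auto simp: algebra_simps)
  moreover have "(norm ((z T - y) + \<eta> *\<^sub>R w T))\<^sup>2 =
      (norm (z T - y))\<^sup>2 - 2 * \<eta> * (w T \<bullet> (y - z T)) + \<eta>\<^sup>2 * (norm (w T))\<^sup>2"
    unfolding power2_norm_eq_inner
    by (simp add: inner_add_left inner_add_right inner_diff_left inner_diff_right inner_commute
        power2_eq_square algebra_simps)
  moreover have "\<eta>\<^sup>2 * (norm (w T))\<^sup>2 \<le> \<eta>\<^sup>2 * L\<^sup>2"
    using norm_w[of T] by (intro mult_left_mono power_mono) auto
  ultimately have "2 * \<eta> * (f y - f (z T)) \<le>
      (norm (z T - y))\<^sup>2 - (norm (z (Suc T) - y))\<^sup>2 + \<eta>\<^sup>2 * L\<^sup>2"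
    using mult_left_mono[of "f y - f (z T)" "w T \<bullet> (y - z T)" "2 * \<eta>"] \<eta> by linarith
  then have "f y - f (z T) \<le>
      ((norm (z T - y))\<^sup>2 - (norm (z (Suc T) - y))\<^sup>2 + \<eta>\<^sup>2 * L\<^sup>2) / (2 * \<eta>)"
    using \<eta> by (simp add: pos_le_divide_eq mult.commute)
  also have "\<dots> = L / (2 * D) * s * ((norm (z T - y))\<^sup>2 - (norm (z (Suc T) - y))\<^sup>2) + L * D * (1 / (2 * s))"
    using s D L by (simp add: \<eta>_def field_simps power2_eq_square)
  finally have incr: "f y - f (z T) \<le> \<dots>" .
  \<comment> \<open>Factoring s^2 - T = 1 shows that the error 1 / (2 s) of one step is absorbed by
    the growth of the square root from T to T + 1.\<close>
  have "1 / (2 * s) \<le> s - sqrt (real T)"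
  proof -
    have "1 = (s - sqrt (real T)) * (s + sqrt (real T))"
      by (simp add: s_def algebra_simps)
    also have "\<dots> \<le> (s - sqrt (real T)) * (2 * s)"
      using s by (intro mult_left_mono) auto
    finally show ?thesis using s by (simp add: field_simps)
  qed
  then have "L * D * (1 / (2 * s)) \<le> L * D * (s - sqrt (real T))"
    using D L by (intro mult_left_mono) auto
  \<comment> \<open>By the diameter bound the last factor is nonnegative, so its coefficient may be
    raised from sqrt T to s. This takes the place of a summation by parts over the varying step
    sizes.\<close>
  moreover have "L / (2 * D) * sqrt (real T) * (D\<^sup>2 - (norm (z T - y))\<^sup>2) \<le>
      L / (2 * D) * s * (D\<^sup>2 - (norm (z T - y))\<^sup>2)"
    using diam[OF z y, of T] s D L by (intro mult_right_mono mult_left_mono) (auto intro: power_mono)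
  ultimately show ?case
    using Suc incr unfolding s_def[symmetric] sum.lessThan_Suc by (simp add: algebra_simps)
qed simp

context cim_bs_instance
begin

text \<open>Independent strategy activation flattens the nested products into one product over pairs
  (v, j), to which both product bounds apply.\<close>

lemma coverage_q_sum:
  assumes R: "R \<subseteq> verts I" and x: "x \<in> nonneg_orthant"
  shows "coverage I x R \<le> min 1 (q_sum I R x)"
    and "alpha * min 1 (q_sum I R x) \<le> coverage I x R"
proof -
  have fin: "finite R" using R finite_verts finite_subset by blast
  let ?a = "\<lambda>(v, j). strat_act I v j (x $ j)"
  have cov: "coverage I x R = 1 - (\<Prod>i\<in>R \<times> UNIV. 1 - ?a i)"
  proof -
    have "(\<Prod>v\<in>R. 1 - act I v x) = (\<Prod>v\<in>R. \<Prod>j\<in>UNIV. 1 - strat_act I v j (x $ j))"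
      using R by (intro prod.cong) (auto simp: act_eq[OF _ x] subset_iff)
    also have "\<dots> = (\<Prod>i\<in>R \<times> UNIV. 1 - ?a i)"
      by (simp add: prod.cartesian_product split_def)
    finally show ?thesis by (simp add: coverage_def)
  qed
  have qs: "q_sum I R x = (\<Sum>i\<in>R \<times> UNIV. ?a i)"
    by (simp add: q_sum_def sum.cartesian_product split_def)
  have bnd: "0 \<le> ?a i \<and> ?a i \<le> 1" if "i \<in> R \<times> UNIV" for i
    using that strat_act_bounds R x by auto
  show "coverage I x R \<le> min 1 (q_sum I R x)"
    unfolding cov qs using bnd by (rule one_minus_prod_le)
  show "alpha * min 1 (q_sum I R x) \<le> coverage I x R"
    unfolding cov qs using fin bnd by (intro one_minus_prod_ge) auto
qed

lemma g_hat_g_bar: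
  assumes Rs: "\<And>R. R \<in> set Rs \<Longrightarrow> R \<subseteq> verts I" and x: "x \<in> nonneg_orthant"
  shows "g_hat I Rs x \<le> g_bar I Rs x" and "alpha * g_bar I Rs x \<le> g_hat I Rs x"
proof -
  show "g_hat I Rs x \<le> g_bar I Rs x"
    unfolding g_hat_coverage g_bar_def using coverage_q_sum(1)[OF Rs x]
    by (intro mult_left_mono sum_list_mono) auto
  have "alpha * (\<Sum>R\<leftarrow>Rs. min 1 (q_sum I R x)) \<le> (\<Sum>R\<leftarrow>Rs. coverage I x R)"
    unfolding sum_list_const_mult[symmetric] using coverage_q_sum(2)[OF Rs x]
    by (intro sum_list_mono) auto
  then have "num_verts I / real (length Rs) * (alpha * (\<Sum>R\<leftarrow>Rs. min 1 (q_sum I R x))) \<le> g_hat I Rs x"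
    unfolding g_hat_coverage by (intro mult_left_mono) auto
  then show "alpha * g_bar I Rs x \<le> g_hat I Rs x"
    by (simp only: g_bar_def mult_ac)
qed

text \<open>The contribution of a single RR set to \<open>sgrad_gbar\<close>, isolated so that the
  supergradient inequality and the norm bound can be shown per set and then averaged.\<close>

definition sgrad_min :: "real ^ 'd \<Rightarrow> 'v set \<Rightarrow> real ^ 'd" where
  "sgrad_min x R = (if q_sum I R x \<ge> 1 then 0 else (\<chi> j. \<Sum>v\<in>R. sgrad_q I v j (x $ j)))"

lemma sgrad_gbar_eq:
  "sgrad_gbar I Rs x = (num_verts I / real (length Rs)) *\<^sub>R (\<Sum>R\<leftarrow>Rs. sgrad_min x R)"
  by (simp add: sgrad_gbar_def sgrad_min_def)

text \<open>If the sum at \<open>x\<close> is at least 1, the capped function is at its maximum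
  there and 0 is a supergradient. Otherwise the cap is inactive at \<open>x\<close> and can only
  lower the value at \<open>y\<close>.\<close>

lemma sgrad_min_supergradient:
  assumes R: "R \<subseteq> verts I" and x: "x \<in> nonneg_orthant" and y: "y \<in> nonneg_orthant"
  shows "min 1 (q_sum I R y) \<le> min 1 (q_sum I R x) + sgrad_min x R \<bullet> (y - x)"
proof (cases "q_sum I R x \<ge> 1")
  case False
  have "q_sum I R y \<le> (\<Sum>v\<in>R. \<Sum>j\<in>UNIV. strat_act I v j (x $ j) + sgrad_q I v j (x $ j) * (y $ j - x $ j))"
    unfolding q_sum_def
  proof (intro sum_mono)
    fix v j assume "v \<in> R"
    then show "strat_act I v j (y $ j) \<le> strat_act I v j (x $ j) + sgrad_q I v j (x $ j) * (y $ j - x $ j)"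
      using sgrad_q[of v "x $ j" j] R x y by (auto simp: supergradient_on_def)
  qed
  also have "\<dots> = q_sum I R x + (\<Sum>j\<in>UNIV. \<Sum>v\<in>R. sgrad_q I v j (x $ j) * (y $ j - x $ j))"
    by (subst (2) sum.swap) (simp add: q_sum_def sum.distrib)
  also have "(\<Sum>j\<in>UNIV. \<Sum>v\<in>R. sgrad_q I v j (x $ j) * (y $ j - x $ j)) = sgrad_min x R \<bullet> (y - x)"
    using False by (simp add: sgrad_min_def inner_vec_def sum_distrib_right)
  finally show ?thesis using False by (simp add: min_def)
qed (simp add: sgrad_min_def)

lemma norm_sgrad_min:
  assumes R: "R \<subseteq> verts I" and x: "x \<in> nonneg_orthant"
  shows "norm (sgrad_min x R) \<le> real (card R) * (sqrt (real CARD('d)) * lip_q I)"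
proof (cases "q_sum I R x \<ge> 1")
  case True
  then show ?thesis using lip_q_nonneg by (simp add: sgrad_min_def)
next
  case False
  have "norm (sgrad_min x R) = L2_set (\<lambda>j. norm (\<Sum>v\<in>R. sgrad_q I v j (x $ j))) UNIV"
    using False by (simp add: sgrad_min_def norm_vec_def)
  also have "\<dots> \<le> L2_set (\<lambda>j. real (card R) * lip_q I) (UNIV :: 'd set)"
  proof (rule L2_set_mono)
    fix j
    have "norm (\<Sum>v\<in>R. sgrad_q I v j (x $ j)) \<le> (\<Sum>v\<in>R. lip_q I)"
      using sgrad_q R x by (intro sum_norm_le) auto
    then show "norm (\<Sum>v\<in>R. sgrad_q I v j (x $ j)) \<le> real (card R) * lip_q I" by simp
  qed simp
  also have "\<dots> = real (card R) * (sqrt (real CARD('d)) * lip_q I)"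
    using lip_q_nonneg by (simp add: L2_set_def real_sqrt_mult)
  finally show ?thesis .
qed

lemma norm_sum_list_le: "norm (\<Sum>R\<leftarrow>Rs. (g R :: real ^ 'd)) \<le> (\<Sum>R\<leftarrow>Rs. norm (g R))"
  by (induction Rs) (auto intro: norm_triangle_le)

lemma inner_sum_list_left: "(\<Sum>R\<leftarrow>Rs. (g R :: real ^ 'd)) \<bullet> z = (\<Sum>R\<leftarrow>Rs. g R \<bullet> z)"
  by (induction Rs) (auto simp: inner_add_left)

lemma inner_supergradient:
  assumes Rs: "\<And>R. R \<in> set Rs \<Longrightarrow> R \<subseteq> verts I" and x: "x \<in> feasible I"
  shows "supergradient_on (feasible I) (\<lambda>x. g_bar I Rs x + saving I x) x (sgrad_gbar I Rs x + sgrad_s I x)"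
    and "norm (sgrad_gbar I Rs x + sgrad_s I x) \<le> inner_lip I Rs"
proof -
  note x' = feasible_nonneg[OF x]
  let ?c = "num_verts I / real (length Rs)"
  show "supergradient_on (feasible I) (\<lambda>x. g_bar I Rs x + saving I x) x (sgrad_gbar I Rs x + sgrad_s I x)"
    unfolding supergradient_on_def
  proof
    fix y assume y: "y \<in> feasible I"
    have "(\<Sum>R\<leftarrow>Rs. min 1 (q_sum I R y)) \<le> (\<Sum>R\<leftarrow>Rs. min 1 (q_sum I R x) + sgrad_min x R \<bullet> (y - x))"
      using sgrad_min_supergradient[OF Rs x' feasible_nonneg[OF y]] by (intro sum_list_mono)
    then have "?c * (\<Sum>R\<leftarrow>Rs. min 1 (q_sum I R y)) \<le>
        ?c * (\<Sum>R\<leftarrow>Rs. min 1 (q_sum I R x) + sgrad_min x R \<bullet> (y - x))"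
      by (intro mult_left_mono) auto
    then have "g_bar I Rs y \<le> g_bar I Rs x + sgrad_gbar I Rs x \<bullet> (y - x)"
      by (simp add: g_bar_def sgrad_gbar_eq sum_list_addf inner_sum_list_left distrib_left)
    moreover have "saving I y \<le> saving I x + sgrad_s I x \<bullet> (y - x)"
      using sgrad_s[OF x] y by (auto simp: supergradient_on_def)
    ultimately show "g_bar I Rs y + saving I y \<le>
        g_bar I Rs x + saving I x + (sgrad_gbar I Rs x + sgrad_s I x) \<bullet> (y - x)"
      by (simp add: inner_add_left)
  qed
  have "norm (sgrad_gbar I Rs x) \<le> ?c * (\<Sum>R\<leftarrow>Rs. norm (sgrad_min x R))"
    by (simp add: sgrad_gbar_eq divide_right_mono mult_left_mono norm_sum_list_le)
  also have "\<dots> \<le> ?c * (\<Sum>R\<leftarrow>Rs. real (card R) * (sqrt (real CARD('d)) * lip_q I))"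
    using norm_sgrad_min[OF Rs x'] by (intro mult_left_mono sum_list_mono) auto
  \<comment> \<open>The norm bound of one set is proportional to its size; averaging is what brings
    \<open>nu1\<close> into the step size and the number of steps.\<close>
  also have "\<dots> = nu1 Rs * num_verts I * sqrt (real CARD('d)) * lip_q I"
    by (simp add: nu1_def sum_list_mult_const)
  finally show "norm (sgrad_gbar I Rs x + sgrad_s I x) \<le> inner_lip I Rs"
    unfolding inner_lip_def using sgrad_s[OF x] by (intro norm_triangle_le add_mono) auto
qed

lemma iterate_feasible: "iterate I Rs t \<in> feasible I"
  by (cases t) (auto simp: start_feasible closest_point_in_set feasible_closed feasible_nonempty)

lemma inner_alg_feasible: "inner_alg I \<epsilon> Rs \<in> feasible I"
proof -
  have "inner_alg I \<epsilon> Rs \<in> iterate I Rs ` {..num_steps I \<epsilon> Rs}"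
    unfolding inner_alg_def by (intro arg_max_on_finite) auto
  then show ?thesis using iterate_feasible by auto
qed

lemma inner_alg_ge_iterate:
  assumes "t \<le> num_steps I \<epsilon> Rs"
  shows "g_bar I Rs (iterate I Rs t) + saving I (iterate I Rs t) \<le>
    g_bar I Rs (inner_alg I \<epsilon> Rs) + saving I (inner_alg I \<epsilon> Rs)"
  unfolding inner_alg_def
  using assms by (intro arg_max_on_finite(2)[where f = "\<lambda>x. g_bar I Rs x + saving I x"]) auto

lemma inner_alg_additive_error:
  assumes Rs: "\<And>R. R \<in> set Rs \<Longrightarrow> R \<subseteq> verts I" and y: "y \<in> feasible I" and "0 < \<epsilon>"
  shows "g_bar I Rs y + saving I y - \<epsilon> / 2 \<le>
    g_bar I Rs (inner_alg I \<epsilon> Rs) + saving I (inner_alg I \<epsilon> Rs)"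
proof -
  let ?f = "\<lambda>x. g_bar I Rs x + saving I x" and ?z = "iterate I Rs" and ?x = "inner_alg I \<epsilon> Rs"
  let ?w = "\<lambda>t. sgrad_gbar I Rs (?z t) + sgrad_s I (?z t)"
  define L where "L = inner_lip I Rs"
  define D where "D = diam_bd I"
  define T where "T = num_steps I \<epsilon> Rs"
  have super: "supergradient_on (feasible I) ?f (?z t) (?w t)" and norm_w: "norm (?w t) \<le> L" for t
    using inner_supergradient[OF Rs iterate_feasible] by (auto simp: L_def)
  have "0 \<le> L" using norm_w[of 0] norm_ge_zero order_trans by blast
  have "0 \<le> D" using feasible_diam[OF y y] by (simp add: D_def)
  \<comment> \<open>If L = 0, the step size is a division by zero, but the supergradient at the
    start vanishes and the start is already optimal. If D = 0, there is only one feasible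
    point.\<close>
  consider "L = 0" | "D = 0" | "0 < L" "0 < D" using \<open>0 \<le> L\<close> \<open>0 \<le> D\<close> by fastforce
  then show ?thesis
  proof cases
    case 1
    then have "?w 0 = 0" using norm_w[of 0] by simp
    then have "?f y \<le> ?f (?z 0)" using super[of 0] y by (simp add: supergradient_on_def)
    also have "\<dots> \<le> ?f ?x" by (rule inner_alg_ge_iterate) simp
    finally show ?thesis using \<open>0 < \<epsilon>\<close> by simp
  next
    case 2
    then have "y = ?x" using feasible_diam[OF y inner_alg_feasible, of \<epsilon> Rs] by (simp add: D_def)
    then show ?thesis using \<open>0 < \<epsilon>\<close> by simp
  next
    case 3
    have T_ge: "9 * D\<^sup>2 * L\<^sup>2 / \<epsilon>\<^sup>2 \<le> real T"
      unfolding T_def num_steps_def D_def L_def by (rule real_nat_ceiling_ge)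
    have "(3 * D * L / \<epsilon>)\<^sup>2 \<le> real T"
      using T_ge by (simp add: power_mult_distrib power_divide)
    then have sqrt_T: "3 * D * L / \<epsilon> \<le> sqrt (real T)" by (rule real_le_rsqrt)
    moreover have "0 < 3 * D * L / \<epsilon>" using 3 \<open>0 < \<epsilon>\<close> by simp
    ultimately have "0 < sqrt (real T)" by linarith
    have "real T * (?f y - ?f ?x) = (\<Sum>t<T. ?f y - ?f ?x)" by simp
    also have "\<dots> \<le> (\<Sum>t<T. ?f y - ?f (?z t))"
      by (intro sum_mono diff_left_mono inner_alg_ge_iterate) (simp add: T_def)
    also have "\<dots> \<le> L / (2 * D) * sqrt (real T) * (D\<^sup>2 - (norm (?z T - y))\<^sup>2) + L * D * sqrt (real T)"
      by (rule projected_supergradient_regret[where f = ?f and z = ?z and w = ?w,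
            OF feasible_convex feasible_closed \<open>0 < D\<close> \<open>0 < L\<close> _ iterate_feasible _ super norm_w y])
         (simp_all add: feasible_diam D_def L_def)
    also have "\<dots> \<le> L / (2 * D) * sqrt (real T) * D\<^sup>2 + L * D * sqrt (real T)"
      using 3 by (intro add_right_mono mult_left_mono) auto
    \<comment> \<open>Over T steps this is an average error of 3/2 L D / sqrt T, and sqrt T >= 3 D L
      / \<epsilon> turns it into \<epsilon> / 2.\<close>
    also have "\<dots> = sqrt (real T) * (3 / 2 * L * D)"
      using 3 by (simp add: power2_eq_square field_simps)
    finally have "sqrt (real T) * (sqrt (real T) * (?f y - ?f ?x)) \<le> sqrt (real T) * (3 / 2 * L * D)"
      by (simp add: mult.assoc[symmetric])
    then have "sqrt (real T) * (?f y - ?f ?x) \<le> 3 / 2 * L * D"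
      using \<open>0 < sqrt (real T)\<close> by (simp only: mult_le_cancel_left_pos)
    moreover have "3 / 2 * L * D \<le> sqrt (real T) * (\<epsilon> / 2)"
      using sqrt_T \<open>0 < \<epsilon>\<close> by (simp add: field_simps)
    ultimately have "sqrt (real T) * (?f y - ?f ?x) \<le> sqrt (real T) * (\<epsilon> / 2)" by linarith
    then have "?f y - ?f ?x \<le> \<epsilon> / 2"
      using \<open>0 < sqrt (real T)\<close> by (simp only: mult_le_cancel_left_pos)
    then show ?thesis by linarith
  qed
qed

text \<open>\<open>g_bar\<close> bounds \<open>g_hat\<close> from above at the comparison point and,
  after scaling by alpha, from below at the output. Scaling the saving by alpha is harmless since it
  is nonnegative on the feasible set; the additive error is scaled as well.\<close>

lemma inner_alg_approx:
  assumes Rs: "\<And>R. R \<in> set Rs \<Longrightarrow> R \<subseteq> verts I" and y: "y \<in> feasible I" and "0 < \<epsilon>"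
  shows "alpha * (g_hat I Rs y + saving I y) - alpha * \<epsilon> / 2 \<le>
    g_hat I Rs (inner_alg I \<epsilon> Rs) + saving I (inner_alg I \<epsilon> Rs)"
proof -
  let ?x = "inner_alg I \<epsilon> Rs"
  have \<alpha>: "0 \<le> alpha" "alpha \<le> 1" by simp_all
  have "alpha * (g_hat I Rs y + saving I y - \<epsilon> / 2) \<le> alpha * (g_bar I Rs y + saving I y - \<epsilon> / 2)"
    using g_hat_g_bar(1)[OF Rs feasible_nonneg[OF y]] \<alpha> by (intro mult_left_mono) auto
  also have "\<dots> \<le> alpha * (g_bar I Rs ?x + saving I ?x)"
    using inner_alg_additive_error[OF Rs y \<open>0 < \<epsilon>\<close>] \<alpha> by (intro mult_left_mono) auto
  also have "\<dots> = alpha * g_bar I Rs ?x + alpha * saving I ?x" by (rule distrib_left)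
  also have "\<dots> \<le> g_hat I Rs ?x + saving I ?x"
    using g_hat_g_bar(2)[OF Rs feasible_nonneg[OF inner_alg_feasible]]
      mult_right_mono[OF \<alpha>(2) saving_nonneg[OF inner_alg_feasible, of \<epsilon> Rs]]
    by (intro add_mono) auto
  finally show ?thesis by (simp add: right_diff_distrib)
qed

end

section \<open>Union bounds and concentration of g_hat\<close>

lemma prob_pmf_mono:
  assumes "\<And>x. x \<in> set_pmf p \<Longrightarrow> x \<in> A \<Longrightarrow> x \<in> B"
  shows "measure_pmf.prob p A \<le> measure_pmf.prob p B"
  by (rule measure_pmf.finite_measure_mono_AE) (use assms in \<open>auto simp: AE_measure_pmf_iff\<close>)

lemma prob_pmf_UN_le:
  assumes "finite N" "\<And>y. y \<in> N \<Longrightarrow> measure_pmf.prob p (A y) \<le> c"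
  shows "measure_pmf.prob p (\<Union>y\<in>N. A y) \<le> real (card N) * c"
proof -
  have "measure_pmf.prob p (\<Union>y\<in>N. A y) \<le> (\<Sum>y\<in>N. measure_pmf.prob p (A y))"
    by (rule measure_pmf.finite_measure_subadditive_finite) (use assms(1) in auto)
  also have "\<dots> \<le> (\<Sum>y\<in>N. c)" using assms(2) by (rule sum_mono)
  finally show ?thesis by simp
qed

text \<open>A union bound for an early exit: the second term runs the continuation on every outcome,
  including those that have exited, so no conditional distribution ever appears.\<close>

lemma prob_bind_if_return_le:
  "measure_pmf.prob (bind_pmf M (\<lambda>x. if P x then return_pmf (v x) else G x)) A
    \<le> measure_pmf.prob M {x. P x \<and> v x \<in> A} + measure_pmf.prob (bind_pmf M G) A"
proof -
  have "emeasure (bind_pmf M (\<lambda>x. if P x then return_pmf (v x) else G x)) A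
      \<le> (\<integral>\<^sup>+x. indicator {x. P x \<and> v x \<in> A} x + emeasure (G x) A \<partial>M)"
    by (simp only: emeasure_bind_pmf) (intro nn_integral_mono, auto simp: indicator_def)
  also have "\<dots> = emeasure M {x. P x \<and> v x \<in> A} + emeasure (bind_pmf M G) A"
    by (subst nn_integral_add) auto
  finally have "ennreal (measure_pmf.prob (bind_pmf M (\<lambda>x. if P x then return_pmf (v x) else G x)) A)
      \<le> ennreal (measure_pmf.prob M {x. P x \<and> v x \<in> A} + measure_pmf.prob (bind_pmf M G) A)"
    by (simp only: measure_pmf.emeasure_eq_measure ennreal_plus measure_nonneg)
  then show ?thesis by (subst (asm) ennreal_le_iff) auto
qed

text \<open>Follows from exp 1 <= 3. The value 2/3 is small enough to close the error budget in
  \<open>final_round_failure\<close>.\<close>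

lemma alpha_bounds: "0 < alpha" "alpha \<le> 2 / 3"
proof -
  have "1 / 3 \<le> 1 / (exp 1 :: real)" using exp_le by (intro divide_left_mono) auto
  then show "alpha \<le> 2 / 3" by simp
qed simp

context cim_bs_instance
begin

text \<open>Dividing by n turns g_hat into an empirical mean of \<open>coverage\<close>, so
  \<open>M\<close> and \<open>\<delta>\<close> are rescaled by 1/n; 0 < m makes that mean a genuine
  average.\<close>

lemma g_hat_tails:
  assumes x: "x \<in> nonneg_orthant" and M: "influence I x \<le> M" "0 < M" and "0 < \<delta>" "0 < m"
  shows g_hat_upper_tail: "measure_pmf.prob (replicate_pmf m (rr_pmf I)) {Rs. g_hat I Rs x \<ge> influence I x + \<delta>}
      \<le> exp (- (real m * \<delta>\<^sup>2 / (num_verts I * (2 * M + 2 / 3 * \<delta>))))"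
    and g_hat_lower_tail: "measure_pmf.prob (replicate_pmf m (rr_pmf I)) {Rs. g_hat I Rs x \<le> influence I x - \<delta>}
      \<le> exp (- (real m * \<delta>\<^sup>2 / (2 * num_verts I * M)))"
proof -
  let ?n = "num_verts I" and ?E = "measure_pmf.expectation (rr_pmf I) (coverage I x)"
  have n: "0 < ?n" using num_verts_ge_1 by linarith
  have E: "?E = influence I x / ?n" using n by (simp add: influence_eq_expectation)
  have bnd: "0 \<le> coverage I x R \<and> coverage I x R \<le> 1" if "R \<in> set_pmf (rr_pmf I)" for R
    using coverage_bounds[OF set_rr_pmf[OF that] x] by simp
  have prems: "?E \<le> M / ?n" "0 < M / ?n" "0 < \<delta> / ?n"
    using M n \<open>0 < \<delta>\<close> by (auto simp: E divide_right_mono)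
  have sum: "(\<Sum>R\<leftarrow>Rs. coverage I x R) = real m * (g_hat I Rs x / ?n)"
    if "Rs \<in> set_pmf (replicate_pmf m (rr_pmf I))" for Rs
    using that n \<open>0 < m\<close> by (simp add: g_hat_coverage set_replicate_pmf)
  have "measure_pmf.prob (replicate_pmf m (rr_pmf I)) {Rs. g_hat I Rs x \<ge> influence I x + \<delta>} \<le>
      measure_pmf.prob (replicate_pmf m (rr_pmf I)) {Rs. (\<Sum>R\<leftarrow>Rs. coverage I x R) \<ge> real m * (?E + \<delta> / ?n)}"
    using n by (intro prob_pmf_mono) (auto simp: sum E add_divide_distrib[symmetric] intro!: mult_left_mono divide_right_mono)
  also have "\<dots> \<le> exp (- (real m * (\<delta> / ?n)\<^sup>2 / (2 * (M / ?n) + 2 / 3 * (\<delta> / ?n))))"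
    by (rule bernstein_replicate_pmf[OF finite_rr_pmf bnd prems \<open>0 < m\<close>])
  also have "real m * (\<delta> / ?n)\<^sup>2 / (2 * (M / ?n) + 2 / 3 * (\<delta> / ?n)) = real m * \<delta>\<^sup>2 / (?n * (2 * M + 2 / 3 * \<delta>))"
  proof -
    have "2 * (M / ?n) + 2 / 3 * (\<delta> / ?n) = (2 * M + 2 / 3 * \<delta>) / ?n" by (simp add: add_divide_distrib)
    then show ?thesis using n by (simp add: power2_eq_square)
  qed
  finally show "measure_pmf.prob (replicate_pmf m (rr_pmf I)) {Rs. g_hat I Rs x \<ge> influence I x + \<delta>}
      \<le> exp (- (real m * \<delta>\<^sup>2 / (?n * (2 * M + 2 / 3 * \<delta>))))" .
  have "measure_pmf.prob (replicate_pmf m (rr_pmf I)) {Rs. g_hat I Rs x \<le> influence I x - \<delta>} \<le>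
      measure_pmf.prob (replicate_pmf m (rr_pmf I)) {Rs. (\<Sum>R\<leftarrow>Rs. coverage I x R) \<le> real m * (?E - \<delta> / ?n)}"
    using n by (intro prob_pmf_mono) (auto simp: sum E diff_divide_distrib[symmetric] intro!: mult_left_mono divide_right_mono)
  also have "\<dots> \<le> exp (- (real m * (\<delta> / ?n)\<^sup>2 / (2 * (M / ?n))))"
    by (rule lower_tail_replicate_pmf[OF finite_rr_pmf bnd prems \<open>0 < m\<close>])
  also have "real m * (\<delta> / ?n)\<^sup>2 / (2 * (M / ?n)) = real m * \<delta>\<^sup>2 / (2 * ?n * M)"
    using n by (simp add: power2_eq_square)
  finally show "measure_pmf.prob (replicate_pmf m (rr_pmf I)) {Rs. g_hat I Rs x \<le> influence I x - \<delta>}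
      \<le> exp (- (real m * \<delta>\<^sup>2 / (2 * ?n * M)))" .
qed

lemma objective_le_opt: "x \<in> feasible I \<Longrightarrow> influence I x + saving I x \<le> opt_value I"
  by (rule objective_maximizer)

lemma feasible_net:
  assumes "0 < r"
  obtains N where "N \<subseteq> feasible I" "finite N" "0 < card N" "card N \<le> covering_number (feasible I) r"
    "\<And>x. x \<in> feasible I \<Longrightarrow> \<exists>y\<in>N. norm (x - y) \<le> r"
  using ex_net_card_le_covering_number[OF feasible_convex feasible_compact feasible_nonempty assms]
  by (metis dist_norm)

section \<open>Search phase: overestimation of OPT is unlikely\<close>

definition search_value :: "real \<Rightarrow> 'v set list \<Rightarrow> real" where
  "search_value \<epsilon> Rs = g_hat I Rs (inner_alg I \<epsilon> Rs) + saving I (inner_alg I \<epsilon> Rs)"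

text \<open>Stated for an unconditioned sample of any size from \<open>theta\<close> upwards, which
  is the form in which a round enters the union bound over the loop.\<close>

lemma search_step_overestimates:
  assumes "0 < \<epsilon>" "0 < l" and lip: "0 < global_lip I" and obj: "1 < log 2 (obj_bound I)" "0 < obj_bound I"
    and "0 < i" and m: "theta I \<epsilon> l i \<le> m"
  defines "b \<equiv> 1 + eps_prime \<epsilon> + \<epsilon> / 3"
  shows "measure_pmf.prob (replicate_pmf m (rr_pmf I))
      {Rs. search_value \<epsilon> Rs \<ge> b * guess I i \<and> opt_value I < search_value \<epsilon> Rs / b}
    \<le> 1 / (2 * num_verts I powr l * log 2 (obj_bound I))"
proof -
  define x where "x = guess I i"
  \<comment> \<open>The two conditions of the event combine to \<open>search_value\<close> >= b * M.
    As M also bounds g on the feasible set, it serves as the mean bound in Bernstein's inequality,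
    and x <= M makes a sample size tuned to x sufficient.\<close>
  define M where "M = max (opt_value I) x"
  define e where "e = eps_prime \<epsilon>"
  define C where "C = real (covering_number (feasible I) (\<epsilon> / 3 / global_lip I * x))"
  \<comment> \<open>The logarithmic numerator of \<open>theta\<close>: in exp (- Z), the factor 1 /
    C pays for the net, and the reciprocal of the logarithm pays for the number of rounds.\<close>
  define Z where "Z = ln C + l * ln (num_verts I) + ln 2 + ln (log 2 (obj_bound I))"
  have n: "1 \<le> num_verts I" "0 < num_verts I" using num_verts_ge_1 by linarith+
  have x: "0 < x" using obj by (simp add: x_def guess_def)
  have e: "0 < e" using \<open>0 < \<epsilon>\<close> by (simp add: e_def)
  have b_eq: "b = 1 + e + \<epsilon> / 3" by (simp add: b_def e_def)
  have b: "0 < b" unfolding b_eq using e \<open>0 < \<epsilon>\<close> by linarith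
  have M: "x \<le> M" "opt_value I \<le> M" "0 < M" using x by (auto simp: M_def)
  have r: "0 < \<epsilon> / 3 / global_lip I * x" using \<open>0 < \<epsilon>\<close> lip x by simp
  from feasible_net[OF r] obtain N where N: "N \<subseteq> feasible I" "finite N" "0 < card N"
    "card N \<le> covering_number (feasible I) (\<epsilon> / 3 / global_lip I * x)"
    "\<And>y. y \<in> feasible I \<Longrightarrow> \<exists>z\<in>N. norm (y - z) \<le> \<epsilon> / 3 / global_lip I * x" by blast
  have C: "1 \<le> C" "real (card N) \<le> C" using N by (auto simp: C_def)
  have "0 \<le> ln C" "0 \<le> l * ln (num_verts I)" "0 < ln (log 2 (obj_bound I))" "0 < ln (2::real)"
    using C n obj \<open>0 < l\<close> by simp_all
  then have Z: "0 < Z" unfolding Z_def by linarith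
  have "num_verts I * (2 + 2 / 3 * e) * (Z / (e\<^sup>2 * x)) \<le> real (theta I \<epsilon> l i)"
    unfolding theta_def Z_def C_def e_def x_def using \<open>0 < i\<close> by (simp add: real_nat_ceiling_ge)
  also have "\<dots> \<le> real m" using m by simp
  finally have m_ge: "num_verts I * (2 + 2 / 3 * e) * (Z / (e\<^sup>2 * x)) \<le> real m" .
  moreover have "0 < num_verts I * (2 + 2 / 3 * e) * (Z / (e\<^sup>2 * x))"
    using n e x Z by (intro mult_pos_pos divide_pos_pos) auto
  ultimately have "0 < m" by linarith
  have single: "measure_pmf.prob (replicate_pmf m (rr_pmf I)) {Rs. g_hat I Rs y \<ge> influence I y + e * M} \<le> exp (- Z)"
    if "y \<in> N" for y
  proof -
    have y: "y \<in> feasible I" using that N by blast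
    have "influence I y \<le> M"
      using objective_le_opt[OF y] saving_nonneg[OF y] M by linarith
    then have "measure_pmf.prob (replicate_pmf m (rr_pmf I)) {Rs. g_hat I Rs y \<ge> influence I y + e * M} \<le>
        exp (- (real m * (e * M)\<^sup>2 / (num_verts I * (2 * M + 2 / 3 * (e * M)))))"
      using e M \<open>0 < m\<close> by (intro g_hat_upper_tail feasible_nonneg[OF y]) auto
    also have "\<dots> \<le> exp (- Z)"
    proof -
      have "Z = num_verts I * (2 + 2 / 3 * e) * (Z / (e\<^sup>2 * x)) * (e\<^sup>2 * x / (num_verts I * (2 + 2 / 3 * e)))"
        using n e x by simp
      also have "\<dots> \<le> real m * (e\<^sup>2 * M / (num_verts I * (2 + 2 / 3 * e)))"
        using m_ge M n e x by (intro mult_mono divide_right_mono mult_left_mono) auto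
      also have "\<dots> = real m * (e * M)\<^sup>2 / (num_verts I * (2 * M + 2 / 3 * (e * M)))"
      proof -
        have "2 * M + 2 / 3 * (e * M) = M * (2 + 2 / 3 * e)" by (simp add: algebra_simps)
        then show ?thesis using M by (simp add: power2_eq_square)
      qed
      finally show ?thesis by simp
    qed
    finally show ?thesis .
  qed
  have "measure_pmf.prob (replicate_pmf m (rr_pmf I))
      {Rs. search_value \<epsilon> Rs \<ge> b * x \<and> opt_value I < search_value \<epsilon> Rs / b}
    \<le> measure_pmf.prob (replicate_pmf m (rr_pmf I)) (\<Union>y\<in>N. {Rs. g_hat I Rs y \<ge> influence I y + e * M})"
  proof (rule prob_pmf_mono)
    fix Rs assume Rs: "Rs \<in> set_pmf (replicate_pmf m (rr_pmf I))"
      and "Rs \<in> {Rs. search_value \<epsilon> Rs \<ge> b * x \<and> opt_value I < search_value \<epsilon> Rs / b}"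
    then have val: "b * M \<le> search_value \<epsilon> Rs"
      using b by (auto simp: M_def max_def field_simps)
    let ?y = "inner_alg I \<epsilon> Rs"
    obtain z where z: "z \<in> N" "norm (?y - z) \<le> \<epsilon> / 3 / global_lip I * x"
      using N(5)[OF inner_alg_feasible] by blast
    have z': "z \<in> feasible I" using z N by blast
    have "search_value \<epsilon> Rs - (g_hat I Rs z + saving I z) \<le> global_lip I * norm (?y - z)"
      unfolding search_value_def
      by (rule g_hat_saving_diff_le[OF set_replicate_rr_pmf[OF Rs] inner_alg_feasible z'])
    also have "\<dots> \<le> global_lip I * (\<epsilon> / 3 / global_lip I * x)"
      using z lip by (intro mult_left_mono) auto
    also have "\<dots> = \<epsilon> / 3 * x" using lip by simp
    also have "\<dots> \<le> \<epsilon> / 3 * M" using M \<open>0 < \<epsilon>\<close> by (intro mult_left_mono) auto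
    finally have "b * M - \<epsilon> / 3 * M \<le> g_hat I Rs z + saving I z" using val by linarith
    moreover have "influence I z + saving I z \<le> M"
      using objective_le_opt[OF z'] M by linarith
    \<comment> \<open>Of b = 1 + e + \<epsilon> / 3, the last summand paid for the move to z and the
      1 covers the objective at z; the saving at z cancels, leaving e * M as deviation of g_hat
      alone.\<close>
    ultimately have "influence I z + e * M \<le> g_hat I Rs z" by (simp add: b_eq algebra_simps)
    then show "Rs \<in> (\<Union>y\<in>N. {Rs. g_hat I Rs y \<ge> influence I y + e * M})" using z by blast
  qed
  also have "\<dots> \<le> real (card N) * exp (- Z)" using N(2) single by (rule prob_pmf_UN_le)
  also have "\<dots> \<le> C * exp (- Z)" using C by (intro mult_right_mono) auto
  also have "exp (- Z) = 1 / (C * num_verts I powr l * 2 * log 2 (obj_bound I))"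
  proof -
    have "exp (ln (log 2 (obj_bound I))) = log 2 (obj_bound I)" using obj(1) by (intro exp_ln) linarith
    moreover have "exp (l * ln (num_verts I)) = num_verts I powr l" using n by (simp add: powr_def)
    ultimately have "exp Z = C * num_verts I powr l * 2 * log 2 (obj_bound I)"
      using C by (simp only: Z_def exp_add) simp
    then show ?thesis by (simp only: exp_minus inverse_eq_divide)
  qed
  also have "C * \<dots> = 1 / (2 * num_verts I powr l * log 2 (obj_bound I))" using C by simp
  finally show ?thesis by (simp add: x_def)
qed

text \<open>Each of the r remaining rounds costs at most p. Generalizing over m keeps the current
  sequence an i.i.d. sample: old and new RR sets merge into one \<open>replicate_pmf\<close>, and
  continuing after an exit only enlarges the bound.\<close>

lemma lb_search_overestimates:
  assumes "0 < i" "theta I \<epsilon> l (i - 1) \<le> m"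
    and step: "\<And>i m. 0 < i \<Longrightarrow> theta I \<epsilon> l i \<le> m \<Longrightarrow> measure_pmf.prob (replicate_pmf m (rr_pmf I))
      {Rs. search_value \<epsilon> Rs \<ge> (1 + eps_prime \<epsilon> + \<epsilon> / 3) * guess I i \<and>
        opt_value I < search_value \<epsilon> Rs / (1 + eps_prime \<epsilon> + \<epsilon> / 3)} \<le> p"
  shows "measure_pmf.prob (bind_pmf (replicate_pmf m (rr_pmf I)) (lb_search I \<epsilon> l r i)) {LB. opt_value I < LB}
    \<le> real r * p"
  using assms(1,2)
proof (induction r arbitrary: i m)
  case 0
  \<comment> \<open>When no passes are left, the result is the default 1, which
    \<open>opt_ge_1\<close> makes a valid lower bound.\<close>
  have "lb_search I \<epsilon> l 0 i = (\<lambda>_. return_pmf 1)" by (simp add: fun_eq_iff)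
  then show ?case using opt_ge_1 by (simp add: bind_pmf_const)
next
  case (Suc r)
  let ?b = "1 + eps_prime \<epsilon> + \<epsilon> / 3"
  \<comment> \<open>Subtraction of natural numbers is truncated at 0; in either case m + k reaches
    \<open>theta I \<epsilon> l i\<close>.\<close>
  define k where "k = theta I \<epsilon> l i - theta I \<epsilon> l (i - 1)"
  have mk: "theta I \<epsilon> l i \<le> m + k" using Suc.prems by (simp add: k_def)
  let ?F = "\<lambda>Rs. if search_value \<epsilon> Rs \<ge> ?b * guess I i then return_pmf (search_value \<epsilon> Rs / ?b)
    else lb_search I \<epsilon> l r (Suc i) Rs"
  have unfold: "lb_search I \<epsilon> l (Suc r) i = (\<lambda>Rs. bind_pmf (replicate_pmf k (rr_pmf I)) (\<lambda>new. ?F (Rs @ new)))"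
    by (simp add: fun_eq_iff Let_def search_value_def k_def cong: if_cong)
  have "bind_pmf (replicate_pmf m (rr_pmf I)) (lb_search I \<epsilon> l (Suc r) i) =
      bind_pmf (replicate_pmf (m + k) (rr_pmf I)) ?F"
    by (simp only: unfold replicate_pmf_distrib bind_assoc_pmf bind_return_pmf)
  then have "measure_pmf.prob (bind_pmf (replicate_pmf m (rr_pmf I)) (lb_search I \<epsilon> l (Suc r) i)) {LB. opt_value I < LB}
    \<le> measure_pmf.prob (replicate_pmf (m + k) (rr_pmf I)) {Rs. search_value \<epsilon> Rs \<ge> ?b * guess I i \<and>
        search_value \<epsilon> Rs / ?b \<in> {LB. opt_value I < LB}} +
      measure_pmf.prob (bind_pmf (replicate_pmf (m + k) (rr_pmf I)) (lb_search I \<epsilon> l r (Suc i))) {LB. opt_value I < LB}"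
    by (simp only: prob_bind_if_return_le)
  also have "\<dots> \<le> p + real r * p"
    using step[OF Suc.prems(1) mk] mk by (intro add_mono Suc.IH) auto
  finally show ?case by (simp add: distrib_right del: lb_search.simps)
qed

text \<open>The final phase divides by LB in its sample sizes and scales its net radius by LB. An
  early exit returns at least the positive guess of its round.\<close>

lemma lb_search_pos:
  assumes "LB \<in> set_pmf (lb_search I \<epsilon> l r i Rs)" "0 < obj_bound I" "0 < \<epsilon>"
  shows "0 < LB"
  using assms(1)
proof (induction r arbitrary: i Rs)
  case (Suc r)
  have b: "0 < 1 + eps_prime \<epsilon> + \<epsilon> / 3" using assms(3) by (intro add_pos_pos) auto
  moreover have "0 < guess I i" using assms(2) by (simp add: guess_def)
  ultimately have pos: "0 < (1 + eps_prime \<epsilon> + \<epsilon> / 3) * guess I i" by (rule mult_pos_pos)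
  let ?v = "\<lambda>Rs. g_hat I Rs (inner_alg I \<epsilon> Rs) + saving I (inner_alg I \<epsilon> Rs)"
  from Suc.prems obtain Rs' where "LB \<in> set_pmf (if ?v Rs' \<ge> (1 + eps_prime \<epsilon> + \<epsilon> / 3) * guess I i
      then return_pmf (?v Rs' / (1 + eps_prime \<epsilon> + \<epsilon> / 3)) else lb_search I \<epsilon> l r (Suc i) Rs')"
    unfolding lb_search.simps Let_def set_bind_pmf by blast
  with Suc.IH b less_le_trans[OF pos] show ?case by (cases "?v Rs' \<ge> (1 + eps_prime \<epsilon> + \<epsilon> / 3) * guess I i") auto
qed simp

lemma lower_bound_overestimates:
  assumes "0 < \<epsilon>" "0 < l" "0 < global_lip I" "0 < obj_bound I"
  shows "measure_pmf.prob (lower_bound I \<epsilon> l) {LB. opt_value I < LB} \<le> 1 / (2 * num_verts I powr l)"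
proof -
  define r where "r = nat \<lfloor>log 2 (obj_bound I) - 1\<rfloor>"
  define p where "p = 1 / (2 * num_verts I powr l * log 2 (obj_bound I))"
  have n: "0 < num_verts I powr l" using num_verts_ge_1 by simp
  have search: "lower_bound I \<epsilon> l = lb_search I \<epsilon> l r 1 []"
    by (simp only: lower_bound_def r_def)
  \<comment> \<open>The empty initial sequence is the sample of size m = 0, which meets the size
    condition because \<open>theta\<close> is 0 at index 0.\<close>
  then have bind: "lower_bound I \<epsilon> l = bind_pmf (replicate_pmf 0 (rr_pmf I)) (lb_search I \<epsilon> l r 1)"
    by (simp add: bind_return_pmf)
  show ?thesis
  proof (cases "r = 0")
    case True
    then show ?thesis using n opt_ge_1 by (simp add: search)
  next
    case False
    \<comment> \<open>At least one round forces log 2 (obj_bound I) >= 2, so the iterated logarithm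
      in \<open>theta\<close> is positive.\<close>
    then have log: "real r \<le> log 2 (obj_bound I)" "1 < log 2 (obj_bound I)"
      unfolding r_def by linarith+
    have "measure_pmf.prob (lower_bound I \<epsilon> l) {LB. opt_value I < LB} \<le> real r * p"
      unfolding bind p_def
      by (intro lb_search_overestimates search_step_overestimates assms log) (simp_all add: theta_def)
    also have "\<dots> \<le> log 2 (obj_bound I) * p"
      using log n by (intro mult_right_mono) (auto simp: p_def)
    also have "\<dots> = 1 / (2 * num_verts I powr l)" using log by (simp add: p_def)
    finally show ?thesis .
  qed
qed

section \<open>Final phase: a large fresh sample makes the output good\<close>

text \<open>The final sample is fresh, so LB can be treated as a constant. Since LB is at most OPT,
  sample sizes that divide by LB are at least those that OPT would demand, and the net is at least
  as fine.\<close>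

lemma final_round_failure:
  assumes "0 < \<epsilon>" "\<epsilon> < alpha" and lip: "0 < global_lip I" and LB: "0 < LB" "LB \<le> opt_value I"
    and m: "theta1 I \<epsilon> l LB \<le> real m" "theta2 I \<epsilon> l LB \<le> real m" and "0 < l"
  shows "measure_pmf.prob (replicate_pmf m (rr_pmf I))
      {Rs. influence I (inner_alg I \<epsilon> Rs) + saving I (inner_alg I \<epsilon> Rs) < (alpha - \<epsilon>) * opt_value I}
    \<le> 1 / (2 * num_verts I powr l)"
proof -
  define a :: real where "a = alpha"
  define a' where "a' = a - \<epsilon> / 3"
  \<comment> \<open>The relative deviations for which \<^const>\<open>theta1\<close> and \<^const>\<open>theta2\<close> are the
    sample sizes required by the lower and the upper tail bound.\<close>
  define e1 where "e1 = a' * \<epsilon> / 6"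
  define e2 where "e2 = \<epsilon> / 3 - 1 / 4 * a'\<^sup>2 * \<epsilon> / 3"
  define n where "n = num_verts I"
  define K where "K = 4 * n powr l"
  define O' where "O' = opt_value I"
  define r where "r = \<epsilon> / 3 / (global_lip I + global_lip I) * LB"
  define C where "C = real (covering_number (feasible I) r)"
  have a: "0 < a" "a \<le> 2 / 3" "\<epsilon> < a" using alpha_bounds assms(2) by (simp_all add: a_def)
  have a': "0 < a'" "a' \<le> a" using a \<open>0 < \<epsilon>\<close> by (simp_all add: a'_def)
  have n: "1 \<le> n" "0 < n" using num_verts_ge_1 by (simp_all add: n_def)
  have K: "1 < K" using n \<open>0 < l\<close> ge_one_powr_ge_zero[of n l] by (simp add: K_def)
  have O': "1 \<le> O'" "0 < O'" "LB \<le> O'" using opt_ge_1 LB by (simp_all add: O'_def)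
  have e1: "0 < e1" using a' \<open>0 < \<epsilon>\<close> by (simp add: e1_def)
  have "a'\<^sup>2 \<le> 1\<^sup>2" using a a' by (intro power_mono) auto
  then have "a'\<^sup>2 * \<epsilon> \<le> \<epsilon>" using \<open>0 < \<epsilon>\<close> by simp
  then have e2: "0 < e2" "e2 \<le> \<epsilon> / 3" using \<open>0 < \<epsilon>\<close> by (simp_all add: e2_def)
  have r: "0 < r" using \<open>0 < \<epsilon>\<close> lip LB by (simp add: r_def)
  have lip_r: "global_lip I * r \<le> \<epsilon> / 6 * O'"
  proof -
    have "global_lip I * r = \<epsilon> / 6 * LB" using lip by (simp add: r_def field_simps)
    then show ?thesis using O' \<open>0 < \<epsilon>\<close> by simp
  qed
  from feasible_net[OF r] obtain N where N: "N \<subseteq> feasible I" "finite N" "0 < card N"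
    "card N \<le> covering_number (feasible I) r"
    "\<And>y. y \<in> feasible I \<Longrightarrow> \<exists>z\<in>N. norm (y - z) \<le> r" by blast
  have C: "1 \<le> C" "real (card N) \<le> C" using N by (auto simp: C_def)
  have KC: "1 < K * C" using K C by (simp add: less_1_mult')
  obtain xs where xs: "xs \<in> feasible I" "influence I xs + saving I xs = O'"
    unfolding O'_def by (rule objective_maximizer)

  have m1: "8 * n * ln K / (LB * a'\<^sup>2 * \<epsilon>\<^sup>2 / 9) \<le> real m"
    using m(1) by (simp add: theta1_def a_def a'_def K_def n_def)
  have m2: "2 * a' * n * ln (K * C) / (e2\<^sup>2 * LB) \<le> real m"
    using m(2) by (simp add: theta2_def a_def a'_def K_def n_def C_def r_def e2_def)
  have "0 < 8 * n * ln K / (LB * a'\<^sup>2 * \<epsilon>\<^sup>2 / 9)"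
    using n K LB a' \<open>0 < \<epsilon>\<close> by simp
  with m1 have "0 < m" by linarith

  let ?P = "measure_pmf.prob (replicate_pmf m (rr_pmf I))"
  let ?low = "{Rs. g_hat I Rs xs \<le> influence I xs - e1 * O'}"
  \<comment> \<open>Only net points close to a failing output matter: there g is below (a -
    \<epsilon>) OPT at the output, and the move to the net adds at most \<epsilon>/6 OPT.\<close>
  let ?N = "{z \<in> N. influence I z \<le> (a - 5 / 6 * \<epsilon>) * O'}"
  let ?high = "\<lambda>z. {Rs. g_hat I Rs z \<ge> influence I z + e2 * O'}"

  have low: "?P ?low \<le> 1 / K"
  proof -
    have "influence I xs \<le> O'" using xs saving_nonneg[OF xs(1)] by linarith
    then have "?P ?low \<le> exp (- (real m * (e1 * O')\<^sup>2 / (2 * num_verts I * O')))"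
      using e1 O' \<open>0 < m\<close> by (intro g_hat_lower_tail feasible_nonneg[OF xs(1)]) auto
    also have "\<dots> \<le> exp (- ln K)"
    proof -
      have "ln K = 8 * n * ln K / (LB * a'\<^sup>2 * \<epsilon>\<^sup>2 / 9) * (LB * e1\<^sup>2 / (2 * n))"
        using n LB a' \<open>0 < \<epsilon>\<close> by (simp add: e1_def power2_eq_square)
      also have "\<dots> \<le> real m * (O' * e1\<^sup>2 / (2 * n))"
        using m1 n O' LB by (intro mult_mono divide_right_mono mult_right_mono) auto
      also have "\<dots> = real m * (e1 * O')\<^sup>2 / (2 * num_verts I * O')"
        using O' by (simp add: n_def power2_eq_square)
      finally show ?thesis by simp
    qed
    also have "\<dots> = 1 / K" using K by (simp add: exp_minus divide_inverse)
    finally show ?thesis .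
  qed

  have high: "?P (?high z) \<le> 1 / (K * C)" if "z \<in> ?N" for z
  proof -
    have z: "z \<in> feasible I" "influence I z \<le> (a - 5 / 6 * \<epsilon>) * O'" using that N by auto
    have "?P (?high z) \<le> exp (- (real m * (e2 * O')\<^sup>2 /
        (num_verts I * (2 * ((a - 5 / 6 * \<epsilon>) * O') + 2 / 3 * (e2 * O')))))"
      using e2 O' a \<open>0 < \<epsilon>\<close> z \<open>0 < m\<close> by (intro g_hat_upper_tail feasible_nonneg mult_pos_pos) auto
    also have "\<dots> \<le> exp (- ln (K * C))"
    proof -
      have "ln (K * C) = 2 * a' * n * ln (K * C) / (e2\<^sup>2 * LB) * (e2\<^sup>2 * LB / (n * (2 * a')))"
        using n LB a' e2 by simp
      also have "\<dots> \<le> real m * (e2\<^sup>2 * O' / (n * (2 * a')))"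
        using m2 n O' LB a' by (intro mult_mono divide_right_mono mult_left_mono) auto
      \<comment> \<open>Here the factor a' of \<open>theta2\<close> is justified: as e2 <=
        \<epsilon>/3, the Bernstein denominator is at most 2 a - 13/9 \<epsilon>, hence at most 2 a'
        = 2 a - 2/3 \<epsilon>.\<close>
      also have "\<dots> \<le> real m * (e2\<^sup>2 * O' / (n * (2 * (a - 5 / 6 * \<epsilon>) + 2 / 3 * e2)))"
        using n O' a e2 a' \<open>0 < \<epsilon>\<close>
        by (intro mult_left_mono divide_left_mono mult_pos_pos add_pos_pos) (auto simp: a'_def)
      also have "\<dots> = real m * (e2 * O')\<^sup>2 /
          (num_verts I * (2 * ((a - 5 / 6 * \<epsilon>) * O') + 2 / 3 * (e2 * O')))"
      proof -
        have "2 * ((a - 5 / 6 * \<epsilon>) * O') + 2 / 3 * (e2 * O') = O' * (2 * (a - 5 / 6 * \<epsilon>) + 2 / 3 * e2)"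
          by (simp add: algebra_simps)
        then show ?thesis using O' by (simp add: n_def power2_eq_square)
      qed
      finally show ?thesis by simp
    qed
    also have "\<dots> = 1 / (K * C)" using KC by (simp add: exp_minus divide_inverse)
    finally show ?thesis .
  qed

  have "?P {Rs. influence I (inner_alg I \<epsilon> Rs) + saving I (inner_alg I \<epsilon> Rs) < (alpha - \<epsilon>) * opt_value I}
    \<le> ?P (?low \<union> (\<Union>z\<in>?N. ?high z))"
  proof (rule prob_pmf_mono)
    fix Rs assume Rs: "Rs \<in> set_pmf (replicate_pmf m (rr_pmf I))" and
      "Rs \<in> {Rs. influence I (inner_alg I \<epsilon> Rs) + saving I (inner_alg I \<epsilon> Rs) < (alpha - \<epsilon>) * opt_value I}"
    then have bad: "influence I (inner_alg I \<epsilon> Rs) + saving I (inner_alg I \<epsilon> Rs) < (a - \<epsilon>) * O'"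
      by (simp add: a_def O'_def)
    let ?y = "inner_alg I \<epsilon> Rs"
    note y = inner_alg_feasible[of \<epsilon> Rs]
    note Rs' = set_replicate_rr_pmf[OF Rs]
    show "Rs \<in> ?low \<union> (\<Union>z\<in>?N. ?high z)"
    proof (cases "Rs \<in> ?low")
      case False
      obtain z where z: "z \<in> N" "norm (?y - z) \<le> r" using N(5)[OF y] by blast
      then have z': "z \<in> feasible I" using N by blast
      have lip_yz: "global_lip I * norm (?y - z) \<le> \<epsilon> / 6 * O'"
        using mult_left_mono[OF z(2), of "global_lip I"] lip lip_r by linarith
      have "(1 - e1) * O' \<le> g_hat I Rs xs + saving I xs"
        using False xs(2) by (simp add: left_diff_distrib)
      then have "a * ((1 - e1) * O') \<le> a * (g_hat I Rs xs + saving I xs)"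
        using a by (intro mult_left_mono) auto
      moreover have "a * (g_hat I Rs xs + saving I xs) - a * \<epsilon> / 2 \<le> g_hat I Rs ?y + saving I ?y"
        unfolding a_def by (rule inner_alg_approx[OF Rs' xs(1) \<open>0 < \<epsilon>\<close>])
      moreover have "a * \<epsilon> / 2 \<le> a * \<epsilon> / 2 * O'"
        using O' a \<open>0 < \<epsilon>\<close> by simp
      ultimately have "(\<epsilon> - a * e1 - a * \<epsilon> / 2) * O' \<le> g_hat I Rs ?y - influence I ?y"
        using bad by (simp add: algebra_simps)
      moreover have "(g_hat I Rs ?y - influence I ?y) - (g_hat I Rs z - influence I z) \<le> \<epsilon> / 6 * O'"
        using g_hat_minus_influence_diff_le[of Rs ?y z, OF Rs' feasible_nonneg[OF y] feasible_nonneg[OF z']] lip_yz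
        by linarith
      \<comment> \<open>With a and a' at most 2/3, the three losses are at most 2/27, 1/3 and 1/6 of
        \<epsilon>. What remains is at least 23/54 \<epsilon>, which exceeds \<epsilon>/3 and hence
        e2.\<close>
      moreover have "e2 * O' \<le> (\<epsilon> - a * e1 - a * \<epsilon> / 2 - \<epsilon> / 6) * O'"
      proof (rule mult_right_mono)
        have "a * a' \<le> 2 / 3 * (2 / 3)" using a a' by (intro mult_mono) auto
        then have "a * a' * \<epsilon> \<le> 4 / 9 * \<epsilon>" "a * \<epsilon> \<le> 2 / 3 * \<epsilon>" using a \<open>0 < \<epsilon>\<close> by auto
        moreover have "a * e1 = a * a' * \<epsilon> / 6" by (simp add: e1_def)
        ultimately show "e2 \<le> \<epsilon> - a * e1 - a * \<epsilon> / 2 - \<epsilon> / 6"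
          using e2 \<open>0 < \<epsilon>\<close> by linarith
      qed (use O' in simp)
      ultimately have "influence I z + e2 * O' \<le> g_hat I Rs z"
        unfolding left_diff_distrib[of "\<epsilon> - a * e1 - a * \<epsilon> / 2" "\<epsilon> / 6" O'] by linarith
      moreover have "influence I z \<le> (a - 5 / 6 * \<epsilon>) * O'"
        using influence_diff_le_norm[OF feasible_nonneg[OF z'] feasible_nonneg[OF y]] lip_yz
          saving_nonneg[OF y] bad by (simp add: norm_minus_commute algebra_simps)
      ultimately show ?thesis using z by blast
    qed simp
  qed
  also have "\<dots> \<le> ?P ?low + ?P (\<Union>z\<in>?N. ?high z)" by (rule measure_Un_le) auto
  also have "\<dots> \<le> 1 / K + real (card ?N) * (1 / (K * C))"
    using N(2) low high by (intro add_mono prob_pmf_UN_le) auto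
  also have "\<dots> \<le> 1 / K + C * (1 / (K * C))"
  proof -
    have "real (card ?N) \<le> real (card N)" using N(2) by (auto intro!: card_mono)
    then show ?thesis using C K by (intro add_left_mono mult_right_mono) auto
  qed
  also have "\<dots> = 1 / (2 * num_verts I powr l)"
    using C by (simp add: K_def n_def)
  finally show ?thesis .
qed

section \<open>Combination of the two phases\<close>

lemma upper_grad_ris_feasible: "x \<in> set_pmf (upper_grad_ris I \<epsilon> l) \<Longrightarrow> x \<in> feasible I"
  by (auto simp: upper_grad_ris_def inner_alg_feasible)

lemma upper_grad_ris_failure:
  assumes "0 < \<epsilon>" "0 < l" "0 < obj_bound I"
  shows "measure_pmf.prob (upper_grad_ris I \<epsilon> l)
      {x. influence I x + saving I x < (alpha - \<epsilon>) * opt_value I} \<le> 1 / num_verts I powr l"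
    (is "measure_pmf.prob ?A ?bad \<le> ?p")
proof -
  have trivial: "measure_pmf.prob ?A ?bad \<le> ?p"
    if "\<And>x. x \<in> feasible I \<Longrightarrow> (alpha - \<epsilon>) * opt_value I \<le> influence I x + saving I x"
  proof -
    have "measure_pmf.prob ?A ?bad \<le> measure_pmf.prob ?A {}"
      by (rule prob_pmf_mono) (use that[OF upper_grad_ris_feasible] in fastforce)
    also have "\<dots> \<le> ?p" by simp
    finally show ?thesis .
  qed
  \<comment> \<open>Two degenerate cases are split off. If alpha <= \<epsilon>, the target is
    nonpositive while the objective is nonnegative. If the Lipschitz constant is 0, the net radii
    take the default value 0, but the objective is constant and every feasible point is
    optimal.\<close>
  consider "alpha \<le> \<epsilon>" | "global_lip I = 0" | "\<epsilon> < alpha" "0 < global_lip I"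
    using global_lip_nonneg by fastforce
  then show ?thesis
  proof cases
    case 1
    then have "(alpha - \<epsilon>) * opt_value I \<le> 0"
      using opt_ge_1 by (intro mult_nonpos_nonneg) auto
    then show ?thesis
      using influence_nonneg saving_nonneg feasible_nonneg by (intro trivial) (meson add_nonneg_nonneg order_trans)
  next
    case 2
    obtain y where y: "y \<in> feasible I" "influence I y + saving I y = opt_value I"
      by (rule objective_maximizer)
    have "alpha - \<epsilon> \<le> 1" using alpha_bounds(2) \<open>0 < \<epsilon>\<close> by linarith
    then have "(alpha - \<epsilon>) * opt_value I \<le> 1 * opt_value I"
      using opt_ge_1 by (intro mult_right_mono) auto
    then show ?thesis
      using objective_diff_le[OF y(1)] y(2) 2 by (intro trivial) fastforce
  next
    case 3
    have "measure_pmf.prob ?A ?bad \<le>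
        measure_pmf.prob (lower_bound I \<epsilon> l) {LB. opt_value I < LB} + 1 / (2 * num_verts I powr l)"
      unfolding upper_grad_ris_def
    proof (rule prob_bind_pmf_le)
      fix LB assume LB: "LB \<in> set_pmf (lower_bound I \<epsilon> l)" "LB \<notin> {LB. opt_value I < LB}"
      define m where "m = nat \<lceil>max (theta1 I \<epsilon> l LB) (theta2 I \<epsilon> l LB)\<rceil>"
      have "max (theta1 I \<epsilon> l LB) (theta2 I \<epsilon> l LB) \<le> real m"
        unfolding m_def by (rule real_nat_ceiling_ge)
      moreover have "0 < LB"
        using LB(1) assms unfolding lower_bound_def by (rule_tac lb_search_pos)
      ultimately have "measure_pmf.prob (replicate_pmf m (rr_pmf I))
          {Rs. influence I (inner_alg I \<epsilon> Rs) + saving I (inner_alg I \<epsilon> Rs) < (alpha - \<epsilon>) * opt_value I}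
        \<le> 1 / (2 * num_verts I powr l)"
        using LB(2) assms 3 by (intro final_round_failure[where LB = LB]) auto
      then show "measure_pmf.prob (bind_pmf (replicate_pmf (nat \<lceil>max (theta1 I \<epsilon> l LB) (theta2 I \<epsilon> l LB)\<rceil>) (rr_pmf I))
          (\<lambda>Rs. return_pmf (inner_alg I \<epsilon> Rs))) ?bad \<le> 1 / (2 * num_verts I powr l)"
        by (simp add: m_def[symmetric] map_pmf_def[symmetric] vimage_def)
    qed simp
    also have "\<dots> \<le> 1 / (2 * num_verts I powr l) + 1 / (2 * num_verts I powr l)"
      using lower_bound_overestimates[OF assms(1,2) 3(2) assms(3)] by simp
    finally show ?thesis by simp
  qed
qed

end

theorem theorem4:
  fixes I :: "('v, 'd::finite) ris_input" and \<epsilon> l :: real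
  assumes "finite (verts I)" and "verts I \<noteq> {}"
    and "edges I \<subseteq> verts I \<times> verts I"
    and "\<And>v. v \<in> verts I \<Longrightarrow> set_pmf (trig I v) \<subseteq> Pow {u. (u, v) \<in> edges I}"
    and "convex (mixes I)" and "mixes I \<subseteq> nonneg_orthant"
    and "saving_wt I \<ge> 0" and "obj_bound I > 0"
    and "feasible I \<noteq> {}" and "closed (feasible I)"
    and "\<And>x y. x \<in> feasible I \<Longrightarrow> y \<in> feasible I \<Longrightarrow> norm (x - y) \<le> diam_bd I"
    and "\<And>v x. v \<in> verts I \<Longrightarrow> x \<in> nonneg_orthant \<Longrightarrow>
           act I v x = 1 - (\<Prod>j\<in>UNIV. 1 - strat_act I v j (x $ j))"
    and "\<And>v j. v \<in> verts I \<Longrightarrow> strat_act I v j ` {0..} \<subseteq> {0..1}"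
    and "\<And>v j. v \<in> verts I \<Longrightarrow> mono_on {0..} (strat_act I v j)"
    and "\<And>v j. v \<in> verts I \<Longrightarrow> concave_on {0..} (strat_act I v j)"
    and "\<And>v j. v \<in> verts I \<Longrightarrow> (lip_q I)-lipschitz_on {0..} (strat_act I v j)"
    and "convex_on (mixes I) (cost I)" and "(lip_c I)-lipschitz_on (mixes I) (cost I)"
    and "start I \<in> feasible I"
    and "\<And>v j a. v \<in> verts I \<Longrightarrow> a \<ge> 0 \<Longrightarrow>
           supergradient_on {0..} (strat_act I v j) a (sgrad_q I v j a) \<and>
           norm (sgrad_q I v j a) \<le> lip_q I"
    and "\<And>x. x \<in> feasible I \<Longrightarrow>
           supergradient_on (feasible I) (saving I) x (sgrad_s I x) \<and>
           norm (sgrad_s I x) \<le> saving_wt I * lip_c I"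
    and "opt_value I \<ge> 1"
    and "\<epsilon> > 0" and "l > 0"
  shows "measure_pmf.prob (upper_grad_ris I \<epsilon> l)
           {x \<in> feasible I. influence I x + saving I x \<ge> (1 - 1 / exp 1 - \<epsilon>) * opt_value I}
         \<ge> 1 - 1 / real (card (verts I)) powr l"
proof -
  interpret cim_bs_instance I
    by unfold_locales (fact assms)+
  let ?A = "upper_grad_ris I \<epsilon> l"
    and ?good = "{x \<in> feasible I. influence I x + saving I x \<ge> (1 - 1 / exp 1 - \<epsilon>) * opt_value I}"
    and ?bad = "{x. influence I x + saving I x < (alpha - \<epsilon>) * opt_value I}"
  have "1 - measure_pmf.prob ?A ?bad = measure_pmf.prob ?A (- ?bad)"
    using measure_pmf.prob_compl[of ?bad ?A] by (simp add: Compl_eq_Diff_UNIV)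
  also have "\<dots> \<le> measure_pmf.prob ?A ?good"
    by (rule prob_pmf_mono) (auto simp: not_less upper_grad_ris_feasible)
  finally show ?thesis
    using upper_grad_ris_failure[OF \<open>\<epsilon> > 0\<close> \<open>l > 0\<close> \<open>obj_bound I > 0\<close>] by linarith
qed

end
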